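(* Let a PDE be first order in time and without mixed derivatives, that is, of the form $\partial_t u=p(\partial_x)u$, $u(0)=u_0\in X_\rho$, where $p(z):=-\sum_{j=0}^m a_jz^j$ is a polynomial function (equivalently, $\partial_t u+\sum_{j=0}^m a_j\,\partial_x^j u=0$ with constant coefficients $a_j$). Then there exists $\rho_0>0$ such that the associated solution semigroup $(e^{tp(\partial_x)})_{t\ge0}$ is Devaney chaotic on $X_\rho$ for every $\rho>\rho_0$.
   Context: For $\rho>0$ the Herzog space is $X_\rho=\{f:\mathbb{R}\to\mathbb{C}: f(x)=\sum_{n\ge0}\frac{a_n\rho^n}{n!}x^n,\ (a_n)_{n\ge0}\in c_0(\mathbb{N}_0)\}$ with norm $\|f\|=\sup_n|a_n|$. The derivative $\partial_x$ is a bounded operator on $X_\rho$, so $p(\partial_x)$ is bounded on $X_\rho$ for all $\rho>0$. A $C_0$-semigroup $(T_t)_{t\ge0}$ is Devaney chaotic if $\{T_tx:t\ge0\}$ is dense for some $x$ and the set of periodic points ($x$ with $T_tx=x$ for some $t>0$) is dense.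
   Formalization: The polynomial p is assumed nonconstant (some a_j with j ≥ 1 is nonzero); for constant p = c the semigroup is e^{tc}I, whose orbits lie in one-dimensional subspaces, so the claim is false. *)

theory Defs
  imports "HOL-Analysis.Analysis" "HOL-Computational_Algebra.Polynomial"
begin

section \<open>Spaces of functions given by a carrier and a norm\<close>

text \<open>
  The Herzog spaces depend on a real parameter, so they are subsets X of the type
  \<^typ>\<open>real \<Rightarrow> complex\<close>, each with its own norm N, rather than types of class
  \<^class>\<open>banach\<close>. Topological notions are those of the library's carrier-based metric spaces,
  and every statement about operators is relativised to X.
\<close>

definition norm_topology ::
    "(real \<Rightarrow> complex) set \<Rightarrow> ((real \<Rightarrow> complex) \<Rightarrow> real) \<Rightarrow> (real \<Rightarrow> complex) topology"
  where "norm_topology X N = Metric_space.mtopology X (\<lambda>f g. N (\<lambda>x. f x - g x))"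

definition bounded_operator_on ::
    "(real \<Rightarrow> complex) set \<Rightarrow> ((real \<Rightarrow> complex) \<Rightarrow> real) \<Rightarrow>
     ((real \<Rightarrow> complex) \<Rightarrow> real \<Rightarrow> complex) \<Rightarrow> bool"
  where "bounded_operator_on X N A \<longleftrightarrow>
    (\<forall>f\<in>X. A f \<in> X) \<and>
    (\<forall>f\<in>X. \<forall>g\<in>X. A (\<lambda>x. f x + g x) = (\<lambda>x. A f x + A g x)) \<and>
    (\<forall>c. \<forall>f\<in>X. A (\<lambda>x. c * f x) = (\<lambda>x. c * A f x)) \<and>
    (\<exists>K. \<forall>f\<in>X. N (A f) \<le> K * N f)"

definition C0_semigroup ::
    "(real \<Rightarrow> complex) set \<Rightarrow> ((real \<Rightarrow> complex) \<Rightarrow> real) \<Rightarrow>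
     (real \<Rightarrow> (real \<Rightarrow> complex) \<Rightarrow> real \<Rightarrow> complex) \<Rightarrow> bool"
  where "C0_semigroup X N T \<longleftrightarrow>
    (\<forall>t\<ge>0. bounded_operator_on X N (T t)) \<and>
    (\<forall>f\<in>X. T 0 f = f) \<and>
    (\<forall>s\<ge>0. \<forall>t\<ge>0. \<forall>f\<in>X. T (s + t) f = T s (T t f)) \<and>
    (\<forall>f\<in>X. \<forall>t\<ge>0. limitin (norm_topology X N) (\<lambda>s. T s f) (T t f) (at t within {0..}))"

definition devaney_chaotic_semigroup ::
    "(real \<Rightarrow> complex) set \<Rightarrow> ((real \<Rightarrow> complex) \<Rightarrow> real) \<Rightarrow>
     (real \<Rightarrow> (real \<Rightarrow> complex) \<Rightarrow> real \<Rightarrow> complex) \<Rightarrow> bool"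
  where "devaney_chaotic_semigroup X N T \<longleftrightarrow>
    C0_semigroup X N T \<and>
    (\<exists>f\<in>X. norm_topology X N closure_of {T t f | t. t \<ge> 0} = X) \<and>
    norm_topology X N closure_of {f\<in>X. \<exists>t>0. T t f = f} = X"

text \<open>
  The exponential \<open>e\<^sup>t\<^sup>A f\<close>, as the limit in X of the partial sums of
  \<open>\<Sum>k. t ^ k / k! A\<^sup>k f\<close>; it is only meaningful for f in X and A bounded on X.
\<close>

definition operator_exp ::
    "(real \<Rightarrow> complex) set \<Rightarrow> ((real \<Rightarrow> complex) \<Rightarrow> real) \<Rightarrow>
     ((real \<Rightarrow> complex) \<Rightarrow> real \<Rightarrow> complex) \<Rightarrow>
     real \<Rightarrow> (real \<Rightarrow> complex) \<Rightarrow> real \<Rightarrow> complex"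
  where "operator_exp X N A t f =
    (THE g. limitin (norm_topology X N)
       (\<lambda>n x. \<Sum>k<n. of_real (t ^ k / fact k) * (A ^^ k) f x) g sequentially)"

definition derivative_operator :: "(real \<Rightarrow> complex) \<Rightarrow> real \<Rightarrow> complex"
  where "derivative_operator f = (\<lambda>x. vector_derivative f (at x))"

definition poly_operator ::
    "complex poly \<Rightarrow> ((real \<Rightarrow> complex) \<Rightarrow> real \<Rightarrow> complex) \<Rightarrow>
     (real \<Rightarrow> complex) \<Rightarrow> real \<Rightarrow> complex"
  where "poly_operator p A f = (\<lambda>x. \<Sum>j\<le>degree p. coeff p j * (A ^^ j) f x)"


section \<open>Herzog spaces\<close>

definition has_herzog_coeffs :: "real \<Rightarrow> (real \<Rightarrow> complex) \<Rightarrow> (nat \<Rightarrow> complex) \<Rightarrow> bool"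
  where "has_herzog_coeffs \<rho> f a \<longleftrightarrow>
    a \<longlonglongrightarrow> 0 \<and> (\<forall>x. (\<lambda>n. a n * of_real (\<rho> ^ n) / fact n * of_real x ^ n) sums f x)"

definition herzog_space :: "real \<Rightarrow> (real \<Rightarrow> complex) set"
  where "herzog_space \<rho> = {f. \<exists>a. has_herzog_coeffs \<rho> f a}"

text \<open>
  The coefficients are unique for \<open>\<rho> > 0\<close>, see \<open>has_herzog_coeffs_unique\<close> below. The value 0
  outside the space is a convention, needed because the library's metric-space locale requires
  distances to be nonnegative on the whole type.
\<close>

definition herzog_norm :: "real \<Rightarrow> (real \<Rightarrow> complex) \<Rightarrow> real"
  where "herzog_norm \<rho> f =
    (if f \<in> herzog_space \<rho> then SUP n. cmod ((THE a. has_herzog_coeffs \<rho> f a) n) else 0)"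

lemma real_powser_zero_imp_zero:
  fixes b :: "nat \<Rightarrow> real"
  assumes "\<And>x. (\<lambda>n. b n * x ^ n) sums 0"
  shows "b n = 0"
proof (induction n rule: less_induct)
  case (less n)
  have "((\<lambda>_. 0) \<longlongrightarrow> b (0 + n)) (at (0::real))"
  proof (rule powser_limit_0_strong[OF zero_less_one])
    fix x :: real
    assume x: "x \<noteq> 0"
    have "(\<lambda>i. b (i + n) * x ^ (i + n)) sums (0 - (\<Sum>i<n. b i * x ^ i))"
      by (rule sums_split_initial_segment[OF assms])
    then have "(\<lambda>i. b (i + n) * x ^ (i + n)) sums 0"
      using less by simp
    then have "(\<lambda>i. b (i + n) * x ^ (i + n) / x ^ n) sums (0 / x ^ n)"
      by (rule sums_divide)
    then show "(\<lambda>i. b (i + n) * x ^ i) sums 0"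
      using x by (simp add: power_add)
  qed
  then show ?case
    using tendsto_unique[OF at_neq_bot _ tendsto_const] by simp blast
qed

lemma has_herzog_coeffs_diff:
  assumes "has_herzog_coeffs \<rho> f a" "has_herzog_coeffs \<rho> g b"
  shows "has_herzog_coeffs \<rho> (\<lambda>x. f x - g x) (\<lambda>n. a n - b n)"
proof -
  have "(\<lambda>n. a n - b n) \<longlonglongrightarrow> 0 - 0"
    using assms by (intro tendsto_diff) (auto simp: has_herzog_coeffs_def)
  moreover have "(\<lambda>n. (a n - b n) * of_real (\<rho> ^ n) / fact n * of_real x ^ n) sums (f x - g x)" for x
    using sums_diff[of "\<lambda>n. a n * of_real (\<rho> ^ n) / fact n * of_real x ^ n" "f x"
        "\<lambda>n. b n * of_real (\<rho> ^ n) / fact n * of_real x ^ n" "g x"] assms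
    by (simp add: has_herzog_coeffs_def left_diff_distrib diff_divide_distrib)
  ultimately show ?thesis
    by (simp add: has_herzog_coeffs_def)
qed

lemma has_herzog_coeffs_unique:
  assumes \<rho>: "\<rho> > 0" and "has_herzog_coeffs \<rho> f a" "has_herzog_coeffs \<rho> f b"
  shows "a = b"
proof
  fix n
  define c where "c n = (a n - b n) * of_real (\<rho> ^ n) / fact n" for n
  have c: "(\<lambda>n. c n * of_real x ^ n) sums 0" for x :: real
    using has_herzog_coeffs_diff[OF assms(2,3)] by (simp add: has_herzog_coeffs_def c_def)
  have "(\<lambda>n. Re (c n) * x ^ n) sums 0" for x :: real
    using sums_Re[OF c[of x]] by (simp del: of_real_power add: of_real_power[symmetric])
  then have "Re (c n) = 0"
    by (rule real_powser_zero_imp_zero)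
  moreover have "(\<lambda>n. Im (c n) * x ^ n) sums 0" for x :: real
    using sums_Im[OF c[of x]] by (simp del: of_real_power add: of_real_power[symmetric])
  then have "Im (c n) = 0"
    by (rule real_powser_zero_imp_zero)
  ultimately have "c n = 0"
    by (simp add: complex_eq_iff)
  then show "a n = b n"
    using \<rho> by (simp add: c_def)
qed

lemma herzog_norm_eq:
  assumes "\<rho> > 0" "has_herzog_coeffs \<rho> f a"
  shows "herzog_norm \<rho> f = (SUP n. cmod (a n))"
proof -
  have "(THE a. has_herzog_coeffs \<rho> f a) = a"
    using assms has_herzog_coeffs_unique by blast
  then show ?thesis
    using assms by (auto simp: herzog_norm_def herzog_space_def)
qed

lemma has_herzog_coeffs_bdd:
  assumes "has_herzog_coeffs \<rho> f a"
  shows "bdd_above (range (\<lambda>n. cmod (a n)))"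
proof -
  have "Bseq a"
    using assms by (auto simp: has_herzog_coeffs_def intro!: convergent_imp_Bseq convergentI)
  then obtain K where "\<forall>n. cmod (a n) \<le> K"
    by (auto simp: Bseq_def)
  then show ?thesis
    by (auto intro!: bdd_aboveI[of _ K])
qed

lemma Metric_space_herzog:
  assumes \<rho>: "\<rho> > 0"
  shows "Metric_space (herzog_space \<rho>) (\<lambda>f g. herzog_norm \<rho> (\<lambda>x. f x - g x))"
proof
  note norm_eq = herzog_norm_eq[OF \<rho>]
  note diff = has_herzog_coeffs_diff
  have upper: "cmod (a n) \<le> (SUP n. cmod (a n))" if "has_herzog_coeffs \<rho> f a" for f a n
    by (rule cSUP_upper[OF UNIV_I has_herzog_coeffs_bdd[OF that]])
  have neg: "has_herzog_coeffs \<rho> (\<lambda>x. - f x) (\<lambda>n. - a n)" if "has_herzog_coeffs \<rho> f a" for f a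
    using that diff[of \<rho> "\<lambda>_. 0" "\<lambda>_. 0" f a] by (simp add: has_herzog_coeffs_def)
  have nonneg: "0 \<le> herzog_norm \<rho> f" for f
  proof (cases "f \<in> herzog_space \<rho>")
    case True
    then obtain a where a: "has_herzog_coeffs \<rho> f a"
      by (auto simp: herzog_space_def)
    show ?thesis
      using order_trans[OF norm_ge_zero upper[OF a]] by (simp add: norm_eq[OF a])
  qed (simp add: herzog_norm_def)
  have minus: "herzog_norm \<rho> (\<lambda>x. - f x) = herzog_norm \<rho> f" for f
  proof (cases "f \<in> herzog_space \<rho>")
    case True
    then obtain a where a: "has_herzog_coeffs \<rho> f a"
      by (auto simp: herzog_space_def)
    show ?thesis
      by (simp add: norm_eq[OF a] norm_eq[OF neg[OF a]])
  next
    case False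
    moreover have "(\<lambda>x. - f x) \<notin> herzog_space \<rho>"
      using False neg[of "\<lambda>x. - f x"] by (auto simp: herzog_space_def)
    ultimately show ?thesis
      by (simp add: herzog_norm_def)
  qed
  fix f g
  show "0 \<le> herzog_norm \<rho> (\<lambda>x. f x - g x)"
    by (rule nonneg)
  show "herzog_norm \<rho> (\<lambda>x. f x - g x) = herzog_norm \<rho> (\<lambda>x. g x - f x)"
    using minus[of "\<lambda>x. f x - g x"] by simp
  assume "f \<in> herzog_space \<rho>" "g \<in> herzog_space \<rho>"
  then obtain a b where a: "has_herzog_coeffs \<rho> f a" and b: "has_herzog_coeffs \<rho> g b"
    by (auto simp: herzog_space_def)
  show "herzog_norm \<rho> (\<lambda>x. f x - g x) = 0 \<longleftrightarrow> f = g"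
  proof
    assume "herzog_norm \<rho> (\<lambda>x. f x - g x) = 0"
    then have "a n = b n" for n
      using upper[OF diff[OF a b], of n] by (simp add: norm_eq[OF diff[OF a b]])
    then have "a = b" ..
    show "f = g"
    proof
      fix x
      show "f x = g x"
        using a b \<open>a = b\<close> by (meson has_herzog_coeffs_def sums_unique2)
    qed
  qed (use norm_eq[OF diff[OF a a]] in simp)
  fix h
  assume "h \<in> herzog_space \<rho>"
  then obtain c where c: "has_herzog_coeffs \<rho> h c"
    by (auto simp: herzog_space_def)
  show "herzog_norm \<rho> (\<lambda>x. f x - h x)
      \<le> herzog_norm \<rho> (\<lambda>x. f x - g x) + herzog_norm \<rho> (\<lambda>x. g x - h x)"
    unfolding norm_eq[OF diff[OF a b]] norm_eq[OF diff[OF b c]] norm_eq[OF diff[OF a c]]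
  proof (rule cSUP_least)
    fix n
    have "cmod (a n - c n) \<le> cmod (a n - b n) + cmod (b n - c n)"
      using norm_triangle_ineq[of "a n - b n" "b n - c n"] by simp
    then show "cmod (a n - c n) \<le> (SUP n. cmod (a n - b n)) + (SUP n. cmod (b n - c n))"
      using upper[OF diff[OF a b], of n] upper[OF diff[OF b c], of n] by linarith
  qed simp
qed

end

theory Submission
  imports Defs "HOL-Computational_Algebra.Fundamental_Theorem_Algebra"
begin

text \<open>
  The map that sends a null sequence a to the function with Herzog coefficients a is an isometric
  isomorphism of the Banach space \<open>c\<^sub>0\<close> onto the Herzog space, and it turns the derivative into
  \<open>\<rho>\<close> times the backward shift. The backward shift has an eigenvector for every w with
  \<open>\<bar>w\<bar> < 1\<close>, the geometric sequence \<open>(w\<^sup>n)\<close>, so \<open>p(\<partial>\<^sub>x)\<close> has the eigenvalues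
  \<open>p(\<rho> w)\<close>, \<open>\<bar>w\<bar> < 1\<close>; on the function side the eigenvectors are exponential functions.
  Chaos is read off from these eigenvalues, following Desch, Schappacher and Webb: the orbits of
  eigenvectors to eigenvalues in the left half plane decay, those to eigenvalues in the right half
  plane can be followed backwards in time to 0, and eigenvectors to eigenvalues in
  \<open>\<i>\<rat>\<close> are periodic. If each of the three families spans a dense subspace, then a Baire
  category argument gives a dense orbit (\<open>universality_criterion\<close>, \<open>dense_orbit\<close>), and
  commensurable periods give a dense subspace of periodic points (\<open>dense_periodic_points\<close>).

  A family of geometric sequences spans a dense subspace as soon as its parameters accumulate
  inside the unit disc (\<open>closure_span_geom\<close>). This is the identity theorem for the
  \<open>c\<^sub>0\<close>-valued holomorphic function \<open>w \<mapsto> (w\<^sup>n)\<close>; its proof works with the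
  closed span itself and does not pass to functionals that annihilate it.

  It remains to find the parameters. The polynomial p tends to infinity at infinity, so
  \<open>{z. \<bar>p z\<bar> \<le> 1}\<close> lies in a disc of some radius r, and any \<open>\<rho>\<^sub>0 \<ge> r\<close> with
  \<open>\<rho>\<^sub>0 > 0\<close> will do. By the fundamental theorem of algebra p attains all values
  \<open>-1/n\<close>, \<open>1/n\<close> and \<open>\<i>/n\<close>, at points of that disc. For \<open>\<rho> > \<rho>\<^sub>0\<close> each of these three
  sequences therefore provides infinitely many eigenvector parameters \<open>w = z/\<rho>\<close> in a compact
  part of the open unit disc, where they accumulate.
\<close>

section \<open>Exponentials of bounded operators\<close>

definition op_exp :: "('a::banach \<Rightarrow> 'a) \<Rightarrow> real \<Rightarrow> 'a \<Rightarrow> 'a"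
  where "op_exp A t x = (\<Sum>k. (t ^ k / fact k) *\<^sub>R (A ^^ k) x)"

lemmas bl_add = linear_add[OF bounded_linear.linear]
lemmas bl_diff = linear_diff[OF bounded_linear.linear]
lemmas bl_scaleR = linear_scale[OF bounded_linear.linear]
lemmas bl_zero = linear_0[OF bounded_linear.linear]

lemma bounded_linear_funpow:
  fixes A :: "'a::real_normed_vector \<Rightarrow> 'a"
  assumes "bounded_linear A"
  shows "bounded_linear (A ^^ k)"
proof (induction k)
  case 0
  then show ?case by (simp add: id_def bounded_linear_ident)
next
  case (Suc k)
  then show ?case
    using bounded_linear_compose[OF assms Suc] by (simp add: o_def)
qed

lemma norm_funpow_le:
  fixes A :: "'a::real_normed_vector \<Rightarrow> 'a"
  assumes "\<And>x. norm (A x) \<le> K * norm x" and "K \<ge> 0"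
  shows "norm ((A ^^ k) x) \<le> K ^ k * norm x"
proof (induction k)
  case (Suc k)
  have "norm ((A ^^ Suc k) x) \<le> K * norm ((A ^^ k) x)"
    using assms(1) by simp
  also have "\<dots> \<le> K * (K ^ k * norm x)"
    using Suc assms(2) by (rule mult_left_mono)
  finally show ?case by simp
qed simp

lemma funpow_intertwine:
  assumes "\<And>a. B (F a) = F (A a)"
  shows "(B ^^ k) (F a) = F ((A ^^ k) a)"
  by (induction k) (simp_all add: assms)

lemma op_exp_majorant:
  fixes A :: "'a::banach \<Rightarrow> 'a"
  assumes "\<And>x. norm (A x) \<le> K * norm x" and "K \<ge> 0"
  shows "norm ((t ^ k / fact k) *\<^sub>R (A ^^ k) x) \<le> (\<bar>t\<bar> * K) ^ k / fact k * norm x"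
    and "(\<lambda>k. (\<bar>t\<bar> * K) ^ k / fact k * norm x) sums (exp (\<bar>t\<bar> * K) * norm x)"
proof -
  have "\<bar>t\<bar> ^ k / fact k * norm ((A ^^ k) x) \<le> \<bar>t\<bar> ^ k / fact k * (K ^ k * norm x)"
    by (intro mult_left_mono norm_funpow_le assms) auto
  then show "norm ((t ^ k / fact k) *\<^sub>R (A ^^ k) x) \<le> (\<bar>t\<bar> * K) ^ k / fact k * norm x"
    by (simp add: power_mult_distrib power_abs mult_ac)
  show "(\<lambda>k. (\<bar>t\<bar> * K) ^ k / fact k * norm x) sums (exp (\<bar>t\<bar> * K) * norm x)"
    using sums_mult2[OF exp_converges, of "\<bar>t\<bar> * K" "norm x"]
    by (simp add: divide_inverse mult_ac)
qed

lemma op_exp_sums: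
  assumes "bounded_linear A"
  shows "(\<lambda>k. (t ^ k / fact k) *\<^sub>R (A ^^ k) x) sums op_exp A t x"
proof -
  obtain K where K: "K \<ge> 0" "\<And>x. norm (A x) \<le> K * norm x"
    using bounded_linear.nonneg_bounded[OF assms] by (auto simp: mult.commute)
  have "summable (\<lambda>k. (t ^ k / fact k) *\<^sub>R (A ^^ k) x)"
    by (rule summable_comparison_test'[OF sums_summable[OF op_exp_majorant(2)[OF K(2,1)]]])
       (rule op_exp_majorant(1)[OF K(2,1)])
  then show ?thesis
    unfolding op_exp_def by (rule summable_sums)
qed

lemma op_exp_norm_le:
  assumes A: "bounded_linear A" and K: "\<And>x. norm (A x) \<le> K * norm x" "K \<ge> 0"
  shows "norm (op_exp A t x) \<le> exp (\<bar>t\<bar> * K) * norm x"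
proof -
  note m = op_exp_majorant[OF K, where t = t and x = x]
  have "norm (op_exp A t x) \<le> (\<Sum>k. (\<bar>t\<bar> * K) ^ k / fact k * norm x)"
    unfolding op_exp_def
    by (rule norm_suminf_le[OF m(1) sums_summable[OF m(2)]])
  then show ?thesis
    using sums_unique[OF m(2)] by simp
qed

lemma op_exp_0: "op_exp A 0 x = x"
proof -
  have "(0 ^ k / fact k) *\<^sub>R (A ^^ k) x = (if k = 0 then x else 0)" for k
    by (cases k) simp_all
  then show ?thesis
    using sums_unique[OF sums_single[of 0 "\<lambda>_. x"]] by (simp add: op_exp_def)
qed

text \<open>
  Anything that intertwines the generators intertwines the exponentials. This serves twice:
  with S a scaling by a complex number it gives complex linearity, and with S a complex line of
  eigenvectors and L a multiplication on the complex numbers it computes the exponential on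
  eigenvectors.
\<close>

lemma op_exp_intertwine:
  fixes L :: "'b::banach \<Rightarrow> 'b" and A :: "'a::banach \<Rightarrow> 'a"
  assumes A: "bounded_linear A" and L: "bounded_linear L" and S: "bounded_linear S"
    and AS: "\<And>y. A (S y) = S (L y)"
  shows "op_exp A t (S y) = S (op_exp L t y)"
proof -
  have "(A ^^ k) (S y) = S ((L ^^ k) y)" for k
    by (rule funpow_intertwine[where B = A and F = S]) (rule AS)
  moreover have "(\<lambda>k. S ((t ^ k / fact k) *\<^sub>R (L ^^ k) y)) sums S (op_exp L t y)"
    by (rule bounded_linear.sums[OF S op_exp_sums[OF L]])
  ultimately show ?thesis
    using op_exp_sums[OF A, of t "S y"]
    by (simp add: bl_scaleR[OF S] sums_unique2)
qed

lemma bounded_linear_op_exp: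
  assumes A: "bounded_linear A"
  shows "bounded_linear (op_exp A t)"
proof -
  obtain K where K: "K \<ge> 0" "\<And>x. norm (A x) \<le> K * norm x"
    using bounded_linear.nonneg_bounded[OF assms] by (auto simp: mult.commute)
  note sums = op_exp_sums[OF A, of t]
  note Ak = bounded_linear_funpow[OF A]
  show ?thesis
  proof (rule bounded_linear_intro[of _ "exp (\<bar>t\<bar> * K)"])
    fix x y
    show "op_exp A t (x + y) = op_exp A t x + op_exp A t y"
      using sums_add[OF sums[of x] sums[of y]] sums[of "x + y"]
      by (simp add: bl_add[OF Ak] scaleR_add_right sums_unique2)
    fix r
    show "op_exp A t (r *\<^sub>R x) = r *\<^sub>R op_exp A t x"
      by (rule op_exp_intertwine[OF A A bounded_linear_scaleR_right])
         (simp add: bl_scaleR[OF A])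
    show "norm (op_exp A t x) \<le> norm x * exp (\<bar>t\<bar> * K)"
      using op_exp_norm_le[OF A K(2,1)] by (simp add: mult.commute)
  qed
qed

lemma op_exp_mult_complex: "op_exp (\<lambda>c. \<mu> * c) t c = exp (of_real t * \<mu>) * (c::complex)"
proof -
  have "((\<lambda>c. \<mu> * c) ^^ k) c = \<mu> ^ k * c" for k
    by (induction k) simp_all
  then have "(\<lambda>k. (of_real t * \<mu>) ^ k /\<^sub>R fact k * c) sums op_exp (\<lambda>c. \<mu> * c) t c"
    using op_exp_sums[OF bounded_linear_mult_right[of \<mu>], of t c]
    by (simp add: scaleR_conv_of_real power_mult_distrib divide_inverse mult_ac)
  then show ?thesis
    using sums_mult2[OF exp_converges] sums_unique2 by blast
qed

section \<open>Dense orbits and dense periodic points\<close>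

lemma subspace_closure:
  fixes V :: "'a::real_normed_vector set"
  assumes V: "subspace V"
  shows "subspace (closure V)"
proof (rule subspaceI)
  show "0 \<in> closure V"
    using subspace_0[OF V] closure_subset by blast
next
  fix x y assume "x \<in> closure V" "y \<in> closure V"
  then obtain f g where "\<And>n. f n \<in> V" "f \<longlonglongrightarrow> x" "\<And>n. g n \<in> V" "g \<longlonglongrightarrow> y"
    unfolding closure_sequential by blast
  then show "x + y \<in> closure V"
    unfolding closure_sequential
    by (intro exI[of _ "\<lambda>n. f n + g n"]) (simp add: subspace_add[OF V] tendsto_add)
next
  fix r x assume "x \<in> closure V"
  then obtain f where "\<And>n. f n \<in> V" "f \<longlonglongrightarrow> x"
    unfolding closure_sequential by blast
  then show "r *\<^sub>R x \<in> closure V"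
    unfolding closure_sequential
    by (intro exI[of _ "\<lambda>n. r *\<^sub>R f n"]) (simp add: subspace_scale[OF V] tendsto_scaleR)
qed

lemma closed_subspace_eq_UNIV:
  fixes V :: "'a::real_normed_vector set"
  assumes "closure (span S) = UNIV" "S \<subseteq> V" "subspace V" "closed V"
  shows "V = UNIV"
  using closure_minimal[OF span_minimal[OF assms(2,3)] assms(4)] assms(1) by auto

lemma dense_subspace:
  fixes V :: "'a::real_normed_vector set"
  assumes "closure (span S) = UNIV" "S \<subseteq> V" "subspace V"
  shows "closure V = UNIV"
  using closure_mono[OF span_minimal[OF assms(2,3)]] assms(1) by auto

text \<open>
  This is the hypercyclicity criterion, for arbitrary sequences of operators. The points whose
  orbit visits a given ball form an open set. It is dense: near x there is a u whose orbit
  tends to 0, near the centre of the ball there is a y that is reached at time n from points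
  \<open>w n\<close> tending to 0, and \<open>u + w n\<close> stays near x while its image at time n tends to y.
  By Baire's theorem, countably many such sets, for balls around the points of D, meet.
\<close>

lemma universality_criterion:
  fixes T :: "nat \<Rightarrow> 'a::banach \<Rightarrow> 'a" and D :: "'a set"
  assumes T: "\<And>n. bounded_linear (T n)"
    and D: "countable D" "closure D = UNIV"
    and null: "closure {x. (\<lambda>n. T n x) \<longlonglongrightarrow> 0} = UNIV"
    and reach: "closure {y. \<exists>w. w \<longlonglongrightarrow> 0 \<and> (\<forall>n. T n (w n) = y)} = UNIV"
  shows "\<exists>x. closure (range (\<lambda>n. T n x)) = UNIV"
proof -
  define G where "G = (\<lambda>(d, k). \<Union>n. {x. dist (T n x) d < inverse (real (Suc k))})"
  have cont: "continuous_on UNIV (T n)" for n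
    by (rule linear_continuous_on[OF T])
  have "open (G q)" for q
  proof -
    have "open {x. dist (T n x) d < r}" for n d r
      by (intro open_Collect_less continuous_intros cont)
    then show ?thesis
      by (auto simp: G_def split: prod.splits)
  qed
  moreover have "closure (G q) = UNIV" for q
  proof -
    obtain d k where q: "q = (d, k)" by force
    have "\<exists>z\<in>G q. dist z x < e" if "e > 0" for x e
    proof -
      define r where "r = inverse (real (Suc k))"
      have r: "r > 0" by (simp add: r_def)
      have "x \<in> closure {x. (\<lambda>n. T n x) \<longlonglongrightarrow> 0}" using null by simp
      then obtain u where u: "(\<lambda>n. T n u) \<longlonglongrightarrow> 0" "dist u x < e"
        using \<open>e > 0\<close> unfolding closure_approachable by blast
      have "d \<in> closure {y. \<exists>w. w \<longlonglongrightarrow> 0 \<and> (\<forall>n. T n (w n) = y)}" using reach by simp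
      then obtain y w where w: "w \<longlonglongrightarrow> 0" "\<And>n. T n (w n) = y" and y: "dist y d < r"
        using r unfolding closure_approachable by blast
      have "(\<lambda>n. dist (u + w n) x) \<longlonglongrightarrow> dist (u + 0) x"
        by (intro tendsto_intros w)
      then have "\<forall>\<^sub>F n in sequentially. dist (u + w n) x < e"
        using u(2) by (intro order_tendstoD(2)) auto
      moreover have "(\<lambda>n. dist (T n (u + w n)) d) \<longlonglongrightarrow> dist (0 + y) d"
        unfolding bl_add[OF T] w(2) by (intro tendsto_intros u)
      then have "\<forall>\<^sub>F n in sequentially. dist (T n (u + w n)) d < r"
        using y by (intro order_tendstoD(2)) auto
      ultimately have "\<forall>\<^sub>F n in sequentially. dist (u + w n) x < e \<and> dist (T n (u + w n)) d < r"
        by (rule eventually_conj)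
      then obtain n where "dist (u + w n) x < e" "dist (T n (u + w n)) d < r"
        using eventually_happens'[OF sequentially_bot] by blast
      then show ?thesis
        by (intro bexI[of _ "u + w n"]) (auto simp: G_def q r_def)
    qed
    then show ?thesis
      by (auto simp: closure_approachable)
  qed
  ultimately have "(euclidean::'a topology) closure_of (\<Inter> (G ` (D \<times> UNIV))) = topspace euclidean"
    by (intro Baire_category disjI1 completely_metrizable_space_euclidean) (use D in auto)
  then have "\<Inter> (G ` (D \<times> UNIV)) \<noteq> {}"
    by fastforce
  then obtain x where x: "\<And>d k. d \<in> D \<Longrightarrow> x \<in> G (d, k)"
    by fastforce
  have "\<exists>z\<in>range (\<lambda>n. T n x). dist z y < e" if "e > 0" for y e
  proof -
    have "y \<in> closure D" using D by simp
    then obtain d where d: "d \<in> D" "dist d y < e / 2"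
      unfolding closure_approachable using half_gt_zero[OF \<open>e > 0\<close>] by blast
    obtain k where "inverse (real (Suc k)) < e / 2"
      using reals_Archimedean[OF half_gt_zero[OF \<open>e > 0\<close>]] by auto
    moreover obtain n where "dist (T n x) d < inverse (real (Suc k))"
      using x[OF d(1), of k] by (auto simp: G_def)
    ultimately have "dist (T n x) y < e"
      using d(2) dist_triangle[of "T n x" y d] by linarith
    then show ?thesis by blast
  qed
  then have "closure (range (\<lambda>n. T n x)) = UNIV"
    unfolding set_eq_iff closure_approachable by simp
  then show ?thesis ..
qed

text \<open>
  The Banach space carries real scalars only, so an eigenvector to a complex eigenvalue
  \<open>ev z\<close> is encoded by the complex line through it: the map \<open>eig z\<close> parametrises that line,
  and A acts on it as multiplication by \<open>ev z\<close>. Real spans of whole lines are complex spans.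
\<close>

locale eigenvector_field =
  fixes A :: "'a::banach \<Rightarrow> 'a" and eig :: "'i \<Rightarrow> complex \<Rightarrow> 'a" and ev :: "'i \<Rightarrow> complex"
  assumes A: "bounded_linear A"
    and eig: "\<And>z. bounded_linear (eig z)"
    and A_eig: "\<And>z c. A (eig z c) = eig z (ev z * c)"
begin

definition eigspan :: "'i set \<Rightarrow> 'a set"
  where "eigspan U = span (\<Union>z\<in>U. range (eig z))"

lemma op_exp_eig: "op_exp A t (eig z c) = eig z (exp (of_real t * ev z) * c)"
  using op_exp_intertwine[OF A bounded_linear_mult_right[of "ev z"] eig[of z]]
  by (simp add: A_eig op_exp_mult_complex)

lemma eig_tendsto_0:
  assumes "(f \<longlongrightarrow> 0) F"
  shows "((\<lambda>x. eig z (f x * c)) \<longlongrightarrow> 0) F"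
  by (intro bounded_linear.tendsto_zero[OF eig] tendsto_mult_left_zero assms)

text \<open>
  On eigenvectors the semigroup law is the functional equation of the scalar exponential;
  density and continuity carry it over to all vectors.
\<close>

lemma op_exp_add:
  assumes "closure (eigspan U) = UNIV"
  shows "op_exp A (s + t) x = op_exp A s (op_exp A t x)"
proof -
  note bl = bounded_linear_op_exp[OF A]
  let ?d = "\<lambda>x. op_exp A (s + t) x - op_exp A s (op_exp A t x)"
  have d: "bounded_linear ?d"
    by (intro bounded_linear_sub bl bounded_linear_compose[OF bl bl])
  have "{x. ?d x = 0} = UNIV"
  proof (rule closed_subspace_eq_UNIV[OF assms[unfolded eigspan_def]])
    show "subspace {x. ?d x = 0}"
      by (rule linear_subspace_kernel[OF bounded_linear.linear[OF d]])
    show "closed {x. ?d x = 0}"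
      by (intro closed_Collect_eq linear_continuous_on d continuous_on_const)
  qed (auto simp: op_exp_eig algebra_simps exp_add)
  then show ?thesis by (auto simp: set_eq_iff)
qed

text \<open>
  Orbits of eigenvectors are continuous, hence so are those of a dense subspace, and the
  exponentials are uniformly bounded near t.
\<close>

lemma op_exp_continuous:
  assumes dense: "closure (eigspan U) = UNIV"
  shows "((\<lambda>s. op_exp A s x) \<longlongrightarrow> op_exp A t x) (at t)"
proof -
  note bl = bounded_linear_op_exp[OF A]
  obtain K where K: "K \<ge> 0" "\<And>x. norm (A x) \<le> K * norm x"
    using bounded_linear.nonneg_bounded[OF A] by (auto simp: mult.commute)
  define M where "M = exp ((\<bar>t\<bar> + 1) * K)"
  have M: "norm (op_exp A s y) \<le> M * norm y" if "dist s t < 1" for s y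
  proof -
    have "\<bar>s\<bar> * K \<le> (\<bar>t\<bar> + 1) * K"
      using that K(1) by (intro mult_right_mono) (auto simp: dist_real_def)
    then have "exp (\<bar>s\<bar> * K) * norm y \<le> M * norm y"
      by (intro mult_right_mono) (auto simp: M_def)
    then show ?thesis
      using op_exp_norm_le[OF A K(2,1), of s y] by linarith
  qed
  have "M > 0" by (simp add: M_def)
  define V where "V = {x. ((\<lambda>s. op_exp A s x) \<longlongrightarrow> op_exp A t x) (at t)}"
  have "closure V = UNIV"
  proof (rule dense_subspace[OF dense[unfolded eigspan_def]])
    show "subspace V"
      unfolding V_def
      by (auto simp: subspace_def bl_add[OF bl] bl_scaleR[OF bl]
          bl_zero[OF bl] intro!: tendsto_intros)
    show "(\<Union>z\<in>U. range (eig z)) \<subseteq> V"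
      by (auto simp: V_def op_exp_eig intro!: bounded_linear.tendsto[OF eig] tendsto_intros)
  qed
  show ?thesis
  proof (rule tendstoI)
    fix e :: real
    assume "e > 0"
    then have "e / (3 * M) > 0" using \<open>M > 0\<close> by simp
    moreover have "x \<in> closure V" using \<open>closure V = UNIV\<close> by simp
    ultimately obtain v where v: "v \<in> V" "dist v x < e / (3 * M)"
      unfolding closure_approachable by blast
    have near: "dist (op_exp A s x) (op_exp A s v) < e / 3" if "dist s t < 1" for s
    proof -
      have "dist (op_exp A s x) (op_exp A s v) \<le> M * dist v x"
        using M[OF that, of "x - v"]
        by (simp add: dist_norm bl_diff[OF bl] norm_minus_commute)
      also have "\<dots> < e / 3"
        using v(2) \<open>M > 0\<close> by (simp add: field_simps)
      finally show ?thesis .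
    qed
    have "\<forall>\<^sub>F s in at t. dist (op_exp A s v) (op_exp A t v) < e / 3"
      using v(1) \<open>e > 0\<close> by (intro tendstoD) (simp_all add: V_def)
    moreover have "\<forall>\<^sub>F s in at t. dist s t < 1"
      by (auto simp: eventually_at intro!: exI[of _ 1])
    ultimately show "\<forall>\<^sub>F s in at t. dist (op_exp A s x) (op_exp A t x) < e"
    proof eventually_elim
      case (elim s)
      have "dist (op_exp A s x) (op_exp A t x) \<le> dist (op_exp A s x) (op_exp A s v)
          + dist (op_exp A s v) (op_exp A t v) + dist (op_exp A t x) (op_exp A t v)"
        using dist_triangle[of "op_exp A s x" "op_exp A t x" "op_exp A s v"]
          dist_triangle[of "op_exp A s v" "op_exp A t x" "op_exp A t v"]
        by (simp add: dist_commute)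
      then show ?case
        using near[OF elim(2)] near[of t] elim(1) by simp
    qed
  qed
qed

text \<open>
  An eigenvector to \<open>\<i>/n\<close> has period \<open>2 \<pi> n\<close>. All these periods are integer multiples
  of \<open>2 \<pi>\<close>, so any two periodic vectors have a common period, and the sum is periodic.
\<close>

lemma dense_periodic_points:
  assumes dense: "closure (eigspan {z. \<exists>n>0. ev z = \<i> / of_nat n}) = UNIV"
  shows "closure {x. \<exists>t>0. op_exp A t x = x} = UNIV"
proof -
  note bl = bounded_linear_op_exp[OF A]
  define P where "P = {x. \<exists>n>0. op_exp A (2 * pi * real n) x = x}"
  have mult: "op_exp A (2 * pi * real (k * n)) x = x" if "op_exp A (2 * pi * real n) x = x" for k n x
  proof (induction k)
    case (Suc k)
    then show ?case
      using that op_exp_add[OF dense, of "2 * pi * real n" "2 * pi * real (k * n)" x]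
      by (simp add: algebra_simps)
  qed (simp add: op_exp_0)
  have "closure P = UNIV"
  proof (rule dense_subspace[OF dense[unfolded eigspan_def]])
    show "subspace P"
    proof (rule subspaceI)
      show "0 \<in> P"
        unfolding P_def using bl_zero[OF bl] by blast
    next
      fix x y assume "x \<in> P" "y \<in> P"
      then obtain m n where mn: "m > 0" "op_exp A (2 * pi * real m) x = x"
          "n > 0" "op_exp A (2 * pi * real n) y = y"
        by (auto simp: P_def)
      have "op_exp A (2 * pi * real (n * m)) (x + y) = x + y"
        using mult[OF mn(2), of n] mult[OF mn(4), of m]
        by (simp only: bl_add[OF bl] mult.commute[of m n])
      then show "x + y \<in> P"
        using mn unfolding P_def by (intro CollectI exI[of _ "n * m"]) auto
    next
      fix r x assume "x \<in> P"
      then show "r *\<^sub>R x \<in> P"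
        by (auto simp: P_def bl_scaleR[OF bl])
    qed
    show "(\<Union>z\<in>{z. \<exists>n>0. ev z = \<i> / of_nat n}. range (eig z)) \<subseteq> P"
    proof clarsimp
      fix z n c
      assume n: "0 < (n::nat)" "ev z = \<i> / of_nat n"
      have "of_real (2 * pi * real n) * (\<i> / of_nat n) = 2 * of_real pi * \<i>"
        using n by simp
      then have "exp (of_real (2 * pi * real n) * ev z) = 1"
        using exp_two_pi_i by (simp only: n(2))
      then show "eig z c \<in> P"
        unfolding P_def using n(1) by (intro CollectI exI[of _ n]) (simp only: op_exp_eig mult_1 simp_thms)
    qed
  qed
  moreover have "P \<subseteq> {x. \<exists>t>0. op_exp A t x = x}"
  proof clarsimp
    fix x assume "x \<in> P"
    then obtain n where "n > 0" "op_exp A (2 * pi * real n) x = x"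
      by (auto simp: P_def)
    then show "\<exists>t>0. op_exp A t x = x"
      by (intro exI[of _ "2 * pi * real n"]) auto
  qed
  ultimately show ?thesis
    using closure_mono by blast
qed

text \<open>
  The integer times suffice. For an eigenvalue with positive real part the orbit is run
  backwards by multiplying with \<open>exp (- n ev z)\<close>, which tends to 0.
\<close>

lemma dense_orbit:
  fixes D :: "'a set"
  assumes D: "countable D" "closure D = UNIV"
    and neg: "closure (eigspan {z. Re (ev z) < 0}) = UNIV"
    and pos: "closure (eigspan {z. Re (ev z) > 0}) = UNIV"
  shows "\<exists>x. closure {op_exp A t x | t. t \<ge> 0} = UNIV"
proof -
  note bl = bounded_linear_op_exp[OF A]
  have decay: "(\<lambda>n. exp (of_nat n * \<mu>)) \<longlonglongrightarrow> 0" if "Re \<mu> < 0" for \<mu>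
  proof -
    have "norm (exp \<mu>) < 1" using that by simp
    from LIMSEQ_power_zero[OF this] show ?thesis
      by (simp add: exp_of_nat_mult)
  qed
  have "\<exists>x. closure (range (\<lambda>n. op_exp A (real n) x)) = UNIV"
  proof (rule universality_criterion[OF bl D])
    show "closure {x. (\<lambda>n. op_exp A (real n) x) \<longlonglongrightarrow> 0} = UNIV"
    proof (rule dense_subspace[OF neg[unfolded eigspan_def]])
      show "subspace {x. (\<lambda>n. op_exp A (real n) x) \<longlonglongrightarrow> 0}"
        unfolding subspace_def mem_Collect_eq bl_add[OF bl] bl_scaleR[OF bl] bl_zero[OF bl]
        using tendsto_add_zero bounded_linear.tendsto_zero[OF bounded_linear_scaleR_right]
        by blast
    qed (auto simp: op_exp_eig intro!: eig_tendsto_0 decay)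
    let ?R = "{y. \<exists>w. w \<longlonglongrightarrow> 0 \<and> (\<forall>n. op_exp A (real n) (w n) = y)}"
    show "closure ?R = UNIV"
    proof (rule dense_subspace[OF pos[unfolded eigspan_def]])
      show "subspace ?R"
      proof (rule subspaceI)
        show "0 \<in> ?R"
          by (auto simp: bl_zero[OF bl] intro!: exI[of _ "\<lambda>_. 0"])
      next
        fix x y assume "x \<in> ?R" "y \<in> ?R"
        then obtain u v where "u \<longlonglongrightarrow> 0" "\<And>n. op_exp A (real n) (u n) = x"
            "v \<longlonglongrightarrow> 0" "\<And>n. op_exp A (real n) (v n) = y"
          by auto
        then show "x + y \<in> ?R"
          by (auto simp: bl_add[OF bl] intro!: exI[of _ "\<lambda>n. u n + v n"] tendsto_add_zero)
      next
        fix r x assume "x \<in> ?R"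
        then obtain u where "u \<longlonglongrightarrow> 0" "\<And>n. op_exp A (real n) (u n) = x"
          by auto
        then show "r *\<^sub>R x \<in> ?R"
          using bounded_linear.tendsto_zero[OF bounded_linear_scaleR_right, of u sequentially r]
          by (auto simp: bl_scaleR[OF bl] intro!: exI[of _ "\<lambda>n. r *\<^sub>R u n"])
      qed
      show "(\<Union>z\<in>{z. Re (ev z) > 0}. range (eig z)) \<subseteq> ?R"
      proof clarsimp
        fix z c assume z: "0 < Re (ev z)"
        have "(\<lambda>n. eig z (exp (of_nat n * - ev z) * c)) \<longlonglongrightarrow> 0"
          using z by (intro eig_tendsto_0 decay) simp
        moreover have "op_exp A (real n) (eig z (exp (of_nat n * - ev z) * c)) = eig z c" for n
          by (simp add: op_exp_eig exp_minus field_simps)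
        ultimately show "\<exists>w. w \<longlonglongrightarrow> 0 \<and> (\<forall>n. op_exp A (real n) (w n) = eig z c)"
          by blast
      qed
    qed
  qed
  then obtain x where x: "closure (range (\<lambda>n. op_exp A (real n) x)) = UNIV" ..
  have "range (\<lambda>n. op_exp A (real n) x) \<subseteq> {op_exp A t x | t. t \<ge> 0}"
    by auto
  from closure_mono[OF this] x show ?thesis by blast
qed

end

section \<open>The Banach space of complex null sequences\<close>

typedef c0 = "{a :: nat \<Rightarrow> complex. a \<longlonglongrightarrow> 0}"
  morphisms entry Abs_c0
  by (auto intro!: exI[of _ "\<lambda>_. 0"])

setup_lifting type_definition_c0

lemma entry_tendsto_0: "entry a \<longlonglongrightarrow> 0"
  using entry[of a] by simp

lemma c0_eqI: "(\<And>n. entry a n = entry b n) \<Longrightarrow> a = b"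
  by (simp add: entry_inject[symmetric] fun_eq_iff)

instantiation c0 :: real_normed_vector
begin

lift_definition zero_c0 :: c0 is "\<lambda>_. 0" by simp

lift_definition plus_c0 :: "c0 \<Rightarrow> c0 \<Rightarrow> c0" is "\<lambda>a b n. a n + b n"
  by (rule tendsto_add_zero)

lift_definition minus_c0 :: "c0 \<Rightarrow> c0 \<Rightarrow> c0" is "\<lambda>a b n. a n - b n"
  using tendsto_diff by fastforce

lift_definition uminus_c0 :: "c0 \<Rightarrow> c0" is "\<lambda>a n. - a n"
  using tendsto_minus by fastforce

lift_definition scaleR_c0 :: "real \<Rightarrow> c0 \<Rightarrow> c0" is "\<lambda>r a n. r *\<^sub>R a n"
  by (rule bounded_linear.tendsto_zero[OF bounded_linear_scaleR_right])

definition norm_c0 :: "c0 \<Rightarrow> real" where "norm a = (SUP n. cmod (entry a n))"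

definition sgn_c0 :: "c0 \<Rightarrow> c0" where "sgn_c0 a = inverse (norm a) *\<^sub>R a"

definition dist_c0 :: "c0 \<Rightarrow> c0 \<Rightarrow> real" where "dist_c0 a b = norm (a - b)"

definition uniformity_c0 :: "(c0 \<times> c0) filter"
  where "uniformity_c0 = (INF e\<in>{0<..}. principal {(x, y). dist x y < e})"

definition open_c0 :: "c0 set \<Rightarrow> bool"
  where "open_c0 S = (\<forall>x\<in>S. \<forall>\<^sub>F (x', y) in uniformity. x' = x \<longrightarrow> y \<in> S)"

lemma bdd_above_entry: "bdd_above (range (\<lambda>n. cmod (entry a n)))"
proof -
  have "Bseq (entry a)"
    using entry_tendsto_0 by (intro convergent_imp_Bseq convergentI)
  then obtain K where "\<forall>n. cmod (entry a n) \<le> K"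
    by (auto simp: Bseq_def)
  then show ?thesis
    by (auto intro!: bdd_aboveI[of _ K])
qed

lemma norm_entry_le: "cmod (entry a n) \<le> norm a"
  unfolding norm_c0_def by (rule cSUP_upper[OF UNIV_I bdd_above_entry])

lemma norm_c0_leI: "(\<And>n. cmod (entry a n) \<le> K) \<Longrightarrow> norm a \<le> K"
  unfolding norm_c0_def by (rule cSUP_least) simp_all

instance
proof
  fix a b c :: c0 and r s :: real
  show "a + b + c = a + (b + c)" by transfer (simp add: fun_eq_iff)
  show "a + b = b + a" by transfer (simp add: fun_eq_iff)
  show "0 + a = a" by transfer (simp add: fun_eq_iff)
  show "- a + a = 0" by transfer (simp add: fun_eq_iff)
  show "a - b = a + - b" by transfer (simp add: fun_eq_iff)
  show "r *\<^sub>R (a + b) = r *\<^sub>R a + r *\<^sub>R b" by transfer (simp add: fun_eq_iff algebra_simps)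
  show "(r + s) *\<^sub>R a = r *\<^sub>R a + s *\<^sub>R a" by transfer (simp add: fun_eq_iff algebra_simps)
  show "r *\<^sub>R s *\<^sub>R a = (r * s) *\<^sub>R a" by transfer (simp add: fun_eq_iff)
  show "1 *\<^sub>R a = a" by transfer (simp add: fun_eq_iff)
  show "dist a b = norm (a - b)" by (rule dist_c0_def)
  show "sgn a = inverse (norm a) *\<^sub>R a" by (rule sgn_c0_def)
  show "(uniformity :: (c0 \<times> c0) filter) = (INF e\<in>{0<..}. principal {(x, y). dist x y < e})"
    by (rule uniformity_c0_def)
  show "open S = (\<forall>x\<in>S. \<forall>\<^sub>F (x', y) in uniformity. x' = x \<longrightarrow> y \<in> S)" for S :: "c0 set"
    by (rule open_c0_def)
  show "norm a = 0 \<longleftrightarrow> a = 0"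
  proof
    assume "norm a = 0"
    then have "entry a n = 0" for n
      using norm_entry_le[of a n] by simp
    then show "a = 0" by (intro c0_eqI) (simp add: zero_c0.rep_eq)
  qed (simp add: norm_c0_def zero_c0.rep_eq)
  show "norm (a + b) \<le> norm a + norm b"
    by (rule norm_c0_leI)
       (auto simp: plus_c0.rep_eq intro: norm_triangle_mono norm_entry_le)
  show "norm (r *\<^sub>R a) = \<bar>r\<bar> * norm a"
  proof (rule antisym)
    show le: "norm (r *\<^sub>R a) \<le> \<bar>r\<bar> * norm a" for r and a :: c0
      by (rule norm_c0_leI) (simp add: scaleR_c0.rep_eq mult_left_mono norm_entry_le)
    have "0 \<le> norm (r *\<^sub>R a)"
      by (rule order_trans[OF norm_ge_zero norm_entry_le])
    moreover have "inverse r *\<^sub>R r *\<^sub>R a = a" if "r \<noteq> 0"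
      using that by transfer (simp add: fun_eq_iff)
    ultimately show "\<bar>r\<bar> * norm a \<le> norm (r *\<^sub>R a)"
      using le[of "inverse r" "r *\<^sub>R a"] by (cases "r = 0") (auto simp: field_simps)
  qed
qed

end

lemma entry_sum: "entry (\<Sum>i\<in>I. f i) n = (\<Sum>i\<in>I. entry (f i) n)"
  by (induction I rule: infinite_finite_induct) (simp_all add: zero_c0.rep_eq plus_c0.rep_eq)

instance c0 :: banach
proof
  fix X :: "nat \<Rightarrow> c0"
  assume X: "Cauchy X"
  have le: "cmod (entry (X m) n - entry (X k) n) \<le> dist (X m) (X k)" for m k n
    using norm_entry_le[of "X m - X k" n] by (simp add: dist_norm minus_c0.rep_eq)
  have "Cauchy (\<lambda>m. entry (X m) n)" for n
  proof (rule metric_CauchyI)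
    fix e :: real
    assume "e > 0"
    then obtain M where M: "\<forall>m\<ge>M. \<forall>k\<ge>M. dist (X m) (X k) < e"
      using metric_CauchyD[OF X] by blast
    show "\<exists>M. \<forall>m\<ge>M. \<forall>k\<ge>M. dist (entry (X m) n) (entry (X k) n) < e"
      unfolding dist_norm
      by (intro exI[of _ M] allI impI order_le_less_trans[OF le]) (use M in blast)
  qed
  then have "\<exists>l. (\<lambda>m. entry (X m) n) \<longlonglongrightarrow> l" for n
    using Cauchy_convergent convergent_def by blast
  then obtain l where l: "\<And>n. (\<lambda>m. entry (X m) n) \<longlonglongrightarrow> l n"
    by metis
  have unif: "\<exists>M. \<forall>m\<ge>M. \<forall>n. cmod (entry (X m) n - l n) \<le> e" if "e > 0" for e
  proof -
    obtain M where M: "\<And>m k. m \<ge> M \<Longrightarrow> k \<ge> M \<Longrightarrow> dist (X m) (X k) < e"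
      using X \<open>e > 0\<close> unfolding Cauchy_def by blast
    have "cmod (entry (X m) n - l n) \<le> e" if "m \<ge> M" for m n
    proof (rule tendsto_upperbound)
      show "(\<lambda>k. cmod (entry (X m) n - entry (X k) n)) \<longlonglongrightarrow> cmod (entry (X m) n - l n)"
        by (intro tendsto_intros l)
      show "\<forall>\<^sub>F k in sequentially. cmod (entry (X m) n - entry (X k) n) \<le> e"
        by (rule eventually_sequentiallyI[of M])
           (rule order_trans[OF le less_imp_le[OF M[OF that]]])
    qed simp
    then show ?thesis by blast
  qed
  have "l \<longlonglongrightarrow> 0"
  proof (rule LIMSEQ_I)
    fix e :: real
    assume "e > 0"
    then obtain m where m: "\<And>n. cmod (entry (X m) n - l n) \<le> e / 2"
      using unif[of "e / 2"] by auto
    obtain N where N: "\<And>n. n \<ge> N \<Longrightarrow> cmod (entry (X m) n) < e / 2"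
      using LIMSEQ_D[OF entry_tendsto_0, of "e / 2" "X m"] \<open>e > 0\<close> by auto
    have "cmod (l n) < e" if "n \<ge> N" for n
      using m[of n] N[OF that] norm_triangle_ineq4[of "entry (X m) n" "entry (X m) n - l n"]
      by simp
    then show "\<exists>N. \<forall>n\<ge>N. norm (l n - 0) < e" by auto
  qed
  then obtain L where L: "entry L = l"
    using Abs_c0_inverse by blast
  have "X \<longlonglongrightarrow> L"
  proof (rule metric_LIMSEQ_I)
    fix e :: real
    assume "e > 0"
    then obtain M where M: "\<And>m n. m \<ge> M \<Longrightarrow> cmod (entry (X m) n - l n) \<le> e / 2"
      using unif[of "e / 2"] by auto
    have "dist (X m) L \<le> e / 2" if "m \<ge> M" for m
      unfolding dist_norm
      using M[OF that] by (intro norm_c0_leI) (simp add: minus_c0.rep_eq L)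
    then show "\<exists>M. \<forall>m\<ge>M. dist (X m) L < e"
      using \<open>e > 0\<close> by (intro exI[of _ M]) fastforce
  qed
  then show "convergent X"
    by (auto simp: convergent_def)
qed

lift_definition cscale :: "complex \<Rightarrow> c0 \<Rightarrow> c0" is "\<lambda>c a n. c * a n"
  by (rule tendsto_mult_right_zero)

lift_definition shift :: "c0 \<Rightarrow> c0" is "\<lambda>a n. a (Suc n)"
  by (rule LIMSEQ_Suc)

lemma bounded_linear_cscale: "bounded_linear (cscale c)"
proof (rule bounded_linear_intro[of _ "cmod c"])
  show "cscale c (a + b) = cscale c a + cscale c b" for a b
    by transfer (simp add: fun_eq_iff algebra_simps)
  show "cscale c (r *\<^sub>R a) = r *\<^sub>R cscale c a" for r a
    by transfer (simp add: fun_eq_iff)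
  show "norm (cscale c a) \<le> norm a * cmod c" for a
    by (rule norm_c0_leI)
       (simp add: cscale.rep_eq norm_mult mult_right_mono norm_entry_le mult.commute[of "cmod c"])
qed

lemma bounded_linear_shift: "bounded_linear shift"
proof (rule bounded_linear_intro[of _ 1])
  show "shift (a + b) = shift a + shift b" for a b
    by transfer (simp add: fun_eq_iff)
  show "shift (r *\<^sub>R a) = r *\<^sub>R shift a" for r a
    by transfer (simp add: fun_eq_iff)
  show "norm (shift a) \<le> norm a * 1" for a
    by (rule norm_c0_leI) (simp add: shift.rep_eq norm_entry_le)
qed

section \<open>Geometric sequences span the null sequences\<close>

lemma binomial_weights_sum:
  fixes s t :: real
  assumes "s \<ge> 0" "t \<ge> 0" "s + t = 1"
  shows "(\<Sum>i\<le>n. real (n choose i) * t ^ i * s ^ (n - i)) = 1"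
  using assms binomial_ring[of t s n] by (simp add: add.commute)

text \<open>
  The summand with index j of \<open>(s + t) ^ (n + j) = 1\<close> is at most 1, which bounds the binomial
  coefficient by a multiple of \<open>s\<close> to the power \<open>-n\<close>. The choice \<open>\<bar>w\<bar> < s < 1\<close> leaves a
  decaying geometric sequence.
\<close>

lemma binomial_geometric_tendsto_0:
  fixes w :: complex
  assumes "cmod w < 1"
  shows "(\<lambda>n. c * of_nat (n choose j) * w ^ (n - j)) \<longlonglongrightarrow> 0"
proof (rule LIMSEQ_offset[where k = j], rule Lim_null_comparison)
  define s t where "s = (1 + cmod w) / 2" and "t = (1 - cmod w) / 2"
  have st: "s > 0" "t > 0" "s + t = 1" "cmod w < s"
    using assms by (auto simp: s_def t_def field_simps intro: add_pos_nonneg)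
  have "cmod (c * of_nat (n + j choose j) * w ^ (n + j - j)) \<le> cmod c / t ^ j * (cmod w / s) ^ n" for n
  proof -
    have "real (n + j choose j) * t ^ j * s ^ (n + j - j) \<le> 1"
      unfolding binomial_weights_sum[OF less_imp_le less_imp_le, OF st(1,2,3), of "n + j", symmetric]
      by (rule member_le_sum) (use st in auto)
    then have "real (n + j choose j) \<le> 1 / (t ^ j * s ^ n)"
      using st by (simp add: field_simps)
    then have "cmod c * real (n + j choose j) * cmod w ^ n \<le> cmod c * (1 / (t ^ j * s ^ n)) * cmod w ^ n"
      by (intro mult_right_mono mult_left_mono) auto
    then show ?thesis
      by (simp add: norm_mult norm_power power_divide)
  qed
  then show "\<forall>\<^sub>F n in sequentially. cmod (c * of_nat (n + j choose j) * w ^ (n + j - j))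
      \<le> cmod c / t ^ j * (cmod w / s) ^ n"
    by simp
  have "cmod w / s < 1" using st by simp
  then show "(\<lambda>n. cmod c / t ^ j * (cmod w / s) ^ n) \<longlonglongrightarrow> 0"
    using st by (intro tendsto_mult_right_zero LIMSEQ_power_zero) simp
qed

text \<open>
  Up to the factor c, this is the Taylor coefficient of order j at w of the map
  \<open>w \<mapsto> (w\<^sup>n)\<close>, that is, \<open>1/j!\<close> times its derivative of order j. Outside the unit disc the
  sequence does not tend to 0; the value 0 chosen there is a degenerate eigenvector to any
  eigenvalue, so that equations for eigenvectors hold for all w.
\<close>

lift_definition jet :: "nat \<Rightarrow> complex \<Rightarrow> complex \<Rightarrow> c0"
  is "\<lambda>j w c n. if cmod w < 1 then c * of_nat (n choose j) * w ^ (n - j) else 0"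
  subgoal for j w c
    by (cases "cmod w < 1") (simp_all add: binomial_geometric_tendsto_0)
  done

abbreviation geom :: "complex \<Rightarrow> complex \<Rightarrow> c0"
  where "geom \<equiv> jet 0"

lemma entry_geom: "entry (geom w c) n = (if cmod w < 1 then c * w ^ n else 0)"
  by (simp add: jet.rep_eq)

lemma entry_jet_0: "entry (jet j 0 c) n = (if n = j then c else 0)"
  by (auto simp: jet.rep_eq power_0_left not_le)

lemma bounded_linear_geom: "bounded_linear (geom w)"
proof (rule bounded_linear_intro[of _ 1])
  show "geom w (c + d) = geom w c + geom w d" for c d
    by (rule c0_eqI) (simp add: entry_geom plus_c0.rep_eq algebra_simps)
  show "geom w (r *\<^sub>R c) = r *\<^sub>R geom w c" for r c
    by (rule c0_eqI) (simp add: entry_geom scaleR_c0.rep_eq)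
  show "norm (geom w c) \<le> norm c * 1" for c
    by (rule norm_c0_leI)
       (simp add: entry_geom norm_mult norm_power mult_left_le power_le_one)
qed

lemma shift_geom: "shift (geom w c) = geom w (w * c)"
  by (rule c0_eqI) (simp add: shift.rep_eq entry_geom)

lemma cscale_geom: "cscale d (geom w c) = geom w (d * c)"
  by (rule c0_eqI) (simp add: cscale.rep_eq entry_geom)

text \<open>
  With \<open>q = \<bar>u - v\<bar> / (1 - \<bar>v\<bar>) \<le> 1\<close>, each term of order \<open>i \<ge> j\<close> in the binomial expansion
  of \<open>(v + (u - v))\<^sup>n\<close> is at most \<open>q\<^sup>j\<close> times the corresponding term of
  \<open>(\<bar>v\<bar> + (1 - \<bar>v\<bar>))\<^sup>n = 1\<close>. The bound does not depend on n, so it holds in norm.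
\<close>

lemma taylor_remainder:
  assumes v: "cmod v < 1" and u: "cmod (u - v) < 1 - cmod v"
  shows "norm (geom u c - (\<Sum>i<j. jet i v (c * (u - v) ^ i)))
    \<le> cmod c * (cmod (u - v) / (1 - cmod v)) ^ j"
proof (rule norm_c0_leI)
  fix n
  define q where "q = cmod (u - v) / (1 - cmod v)"
  have q: "0 \<le> q" "q \<le> 1" and uq: "cmod (u - v) = q * (1 - cmod v)"
    using u v by (auto simp: q_def)
  have "cmod u < 1"
    using u norm_triangle_sub[of u v] by simp
  let ?t = "\<lambda>i. of_nat (n choose i) * (u - v) ^ i * v ^ (n - i)"
  have bound: "cmod (?t i) \<le> q ^ j * (real (n choose i) * (1 - cmod v) ^ i * cmod v ^ (n - i))"
    if "i \<ge> j" for i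
  proof -
    have "q ^ i \<le> q ^ j"
      using q that by (intro power_decreasing)
    then have "q ^ i * (real (n choose i) * (1 - cmod v) ^ i * cmod v ^ (n - i))
        \<le> q ^ j * (real (n choose i) * (1 - cmod v) ^ i * cmod v ^ (n - i))"
      using v by (intro mult_right_mono) auto
    then show ?thesis
      by (simp add: norm_mult norm_power uq power_mult_distrib mult_ac)
  qed
  have "u ^ n = (\<Sum>i\<le>n. ?t i)"
    using binomial_ring[of "u - v" v n] by simp
  also have "\<dots> = (\<Sum>i\<in>{..<j} \<inter> {..n}. ?t i) + (\<Sum>i\<in>{j..n}. ?t i)"
    by (subst sum.union_disjoint[symmetric]) (auto intro!: sum.cong)
  also have "(\<Sum>i\<in>{..<j} \<inter> {..n}. ?t i) = (\<Sum>i<j. ?t i)"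
    by (rule sum.mono_neutral_left) auto
  finally have "entry (geom u c - (\<Sum>i<j. jet i v (c * (u - v) ^ i))) n = c * (\<Sum>i\<in>{j..n}. ?t i)"
    using v \<open>cmod u < 1\<close>
    by (simp add: minus_c0.rep_eq entry_sum jet.rep_eq sum_distrib_left algebra_simps)
  also have "cmod \<dots> \<le> cmod c * (\<Sum>i\<in>{j..n}. q ^ j * (real (n choose i) * (1 - cmod v) ^ i * cmod v ^ (n - i)))"
    unfolding norm_mult by (intro mult_left_mono sum_norm_le bound) auto
  also have "\<dots> \<le> cmod c * (\<Sum>i\<le>n. q ^ j * (real (n choose i) * (1 - cmod v) ^ i * cmod v ^ (n - i)))"
    using v q by (intro mult_left_mono sum_mono2) auto
  also have "\<dots> = cmod c * q ^ j"
    using binomial_weights_sum[of "cmod v" "1 - cmod v" n] v by (simp flip: sum_distrib_left)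
  finally show "cmod (entry (geom u c - (\<Sum>i<j. jet i v (c * (u - v) ^ i))) n) \<le> cmod c * (cmod (u - v) / (1 - cmod v)) ^ j"
    by (simp add: q_def)
qed

text \<open>
  The Taylor coefficient of order j is the limit, as u tends to v through parameters of
  geometric sequences in V, of the Taylor remainder of order j divided by \<open>(u - v)\<^sup>j\<close>. The
  remainder involves only lower Taylor coefficients, which lie in V by induction.
\<close>

lemma jets_in_closed_subspace:
  assumes V: "subspace V" "closed V"
    and v: "cmod v < 1" "v islimpt {w. \<forall>c. geom w c \<in> V}"
  shows "jet j v c \<in> V"
proof (induction j arbitrary: c rule: less_induct)
  case (less j)
  define \<delta> where "\<delta> = 1 - cmod v"
  have "\<delta> > 0" using v by (simp add: \<delta>_def)
  obtain u where u: "\<And>k. u k \<in> {w. \<forall>c. geom w c \<in> V} - {v}" "u \<longlonglongrightarrow> v"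
    using v(2) by (auto simp: islimpt_sequential)
  \<comment> \<open>the division by \<open>(u - v)\<^sup>j\<close> is carried out inside the argument c\<close>
  define x where "x = (\<lambda>k. geom (u k) (c / (u k - v) ^ j)
      - (\<Sum>i<j. jet i v (c / (u k - v) ^ j * (u k - v) ^ i)))"
  have "x k \<in> V" for k
    unfolding x_def using u(1)[of k] less.IH
    by (intro subspace_diff subspace_sum V) auto
  moreover have "x \<longlonglongrightarrow> jet j v c"
  proof -
    have uv0: "(\<lambda>k. cmod (u k - v)) \<longlonglongrightarrow> 0"
      using tendsto_norm_zero[OF LIM_zero[OF u(2)]] .
    have "\<forall>\<^sub>F k in sequentially. cmod (u k - v) < \<delta>"
      using uv0 \<open>\<delta> > 0\<close> by (rule order_tendstoD(2))
    then have "\<forall>\<^sub>F k in sequentially. norm (x k - jet j v c) \<le> cmod (u k - v) * (cmod c / \<delta> ^ Suc j)"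
    proof eventually_elim
      case (elim k)
      have ne: "u k - v \<noteq> 0" using u(1)[of k] by simp
      have "x k - jet j v c = geom (u k) (c / (u k - v) ^ j)
          - (\<Sum>i<Suc j. jet i v (c / (u k - v) ^ j * (u k - v) ^ i))"
        using ne by (simp add: x_def)
      also have "norm \<dots> \<le> cmod (c / (u k - v) ^ j) * (cmod (u k - v) / \<delta>) ^ Suc j"
        unfolding \<delta>_def
        by (rule taylor_remainder) (use elim v(1) in \<open>simp_all add: \<delta>_def\<close>)
      also have "\<dots> = cmod (u k - v) * (cmod c / \<delta> ^ Suc j)"
        using ne by (simp add: norm_divide norm_power power_divide)
      finally show ?case .
    qed
    moreover have "(\<lambda>k. cmod (u k - v) * (cmod c / \<delta> ^ Suc j)) \<longlonglongrightarrow> 0"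
      by (intro tendsto_mult_left_zero uv0)
    ultimately have "(\<lambda>k. x k - jet j v c) \<longlonglongrightarrow> 0"
      by (rule Lim_null_comparison)
    then show ?thesis
      by (rule LIM_zero_cancel)
  qed
  ultimately show ?case
    by (rule closed_sequentially[OF V(2)])
qed

lemma geom_in_closed_subspace:
  assumes V: "subspace V" "closed V"
    and v: "cmod v < 1" "v islimpt {w. \<forall>c. geom w c \<in> V}" and u: "cmod (u - v) < 1 - cmod v"
  shows "geom u c \<in> V"
proof -
  define q where "q = cmod (u - v) / (1 - cmod v)"
  have q: "0 \<le> q" "q < 1"
    using u v(1) by (auto simp: q_def)
  have "(\<lambda>j. geom u c - (\<Sum>i<j. jet i v (c * (u - v) ^ i))) \<longlonglongrightarrow> 0"
  proof (rule Lim_null_comparison)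
    show "\<forall>\<^sub>F j in sequentially. norm (geom u c - (\<Sum>i<j. jet i v (c * (u - v) ^ i))) \<le> cmod c * q ^ j"
      using taylor_remainder[OF v(1) u] by (simp add: q_def)
    show "(\<lambda>j. cmod c * q ^ j) \<longlonglongrightarrow> 0"
      using q by (intro tendsto_mult_right_zero LIMSEQ_power_zero) simp
  qed
  from tendsto_diff[OF tendsto_const[of "geom u c"] this]
  have "(\<lambda>j. \<Sum>i<j. jet i v (c * (u - v) ^ i)) \<longlonglongrightarrow> geom u c"
    by simp
  moreover have "(\<Sum>i<j. jet i v (c * (u - v) ^ i)) \<in> V" for j
    by (intro subspace_sum V jets_in_closed_subspace v)
  ultimately show ?thesis
    by (rule closed_sequentially[OF V(2), rotated])
qed

lemma finite_support_tendsto: "(\<lambda>N. \<Sum>j<N. jet j 0 (entry a j)) \<longlonglongrightarrow> a"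
proof (rule metric_LIMSEQ_I)
  fix e :: real
  assume "e > 0"
  then obtain M where M: "\<And>n. n \<ge> M \<Longrightarrow> cmod (entry a n) < e / 2"
    using LIMSEQ_D[OF entry_tendsto_0, of "e / 2" a] by auto
  have "dist (\<Sum>j<N. jet j 0 (entry a j)) a \<le> e / 2" if "N \<ge> M" for N
    unfolding dist_norm
    by (rule norm_c0_leI)
       (use M that \<open>e > 0\<close> in \<open>auto simp: minus_c0.rep_eq entry_sum entry_jet_0 not_less less_imp_le\<close>)
  then show "\<exists>M. \<forall>N\<ge>M. dist (\<Sum>j<N. jet j 0 (entry a j)) a < e"
    using \<open>e > 0\<close> by (intro exI[of _ M]) fastforce
qed

text \<open>
  The points of the disc at which the geometric sequences in the closed span V accumulate form a
  set S that is closed in the disc. It is also open: by the Taylor series at \<open>w \<in> S\<close>, all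
  geometric sequences with parameters near w lie in V. The disc is connected, so \<open>0 \<in> S\<close>, and
  the Taylor coefficients at 0 are the unit vectors.
\<close>

lemma closure_span_geom:
  assumes U: "U \<subseteq> ball 0 1" "v islimpt U" and v: "cmod v < 1"
  shows "closure (span (\<Union>w\<in>U. range (geom w))) = UNIV"
proof -
  define V where "V = closure (span (\<Union>w\<in>U. range (geom w)))"
  have V: "subspace V" "closed V"
    by (simp_all add: V_def subspace_closure)
  define G where "G = {w. \<forall>c. geom w c \<in> V}"
  have "U \<subseteq> G"
    using closure_subset[of "span (\<Union>w\<in>U. range (geom w))"]
    by (auto simp: G_def V_def intro!: subsetD[OF closure_subset] span_base)
  define S where "S = ball 0 1 \<inter> {w. w islimpt G}"
  have sub: "ball w (1 - cmod w) \<subseteq> S" if "w \<in> S" for w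
  proof -
    have "ball w (1 - cmod w) \<subseteq> G"
      using that by (auto simp: G_def S_def dist_norm norm_minus_commute intro!: geom_in_closed_subspace[OF V, of w])
    then have "z islimpt G" if "z \<in> ball w (1 - cmod w)" for z
      using that interior_limit_point[of z "ball w (1 - cmod w)"]
      by (auto simp: interior_open intro: islimpt_subset)
    moreover have "ball w (1 - cmod w) \<subseteq> ball 0 1"
    proof
      fix z assume "z \<in> ball w (1 - cmod w)"
      then show "z \<in> ball 0 1"
        using norm_triangle_sub[of z w] by (simp add: dist_norm norm_minus_commute)
    qed
    ultimately show ?thesis
      by (auto simp: S_def)
  qed
  have "openin (top_of_set (ball 0 1)) S"
  proof (rule open_openin_trans)
    show "open S"
      unfolding open_contains_ball
    proof
      fix w assume "w \<in> S"
      with sub[OF this] show "\<exists>e>0. ball w e \<subseteq> S"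
        by (intro exI[of _ "1 - cmod w"]) (auto simp: S_def)
    qed
  qed (auto simp: S_def)
  moreover have "closedin (top_of_set (ball 0 1)) S"
    unfolding S_def by (intro closedin_closed_Int closed_limpts)
  moreover have "v \<in> S"
    using islimpt_subset[OF U(2) \<open>U \<subseteq> G\<close>] v by (simp add: S_def)
  ultimately have "S = ball 0 1"
    using convex_connected[OF convex_ball, of "0::complex" 1] unfolding connected_clopen by blast
  then have "0 \<in> S"
    by simp
  then have "0 islimpt G"
    unfolding S_def by simp
  then have "jet j 0 c \<in> V" for j c
    by (intro jets_in_closed_subspace V) (simp_all add: G_def)
  then have "(\<Sum>j<N. jet j 0 (entry a j)) \<in> V" for N a
    by (intro subspace_sum V)
  then have "a \<in> V" for a
    by (rule closed_sequentially[OF V(2) _ finite_support_tendsto])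
  then have "V = UNIV" by blast
  then show ?thesis by (simp only: V_def)
qed

text \<open>
  Finitely supported sequences with entries in a countable dense set of complex numbers,
  encoded as lists, are dense.
\<close>

lemma separable_c0: "\<exists>D :: c0 set. countable D \<and> closure D = UNIV"
proof -
  obtain Q :: "complex set" where Q: "countable Q" "\<And>X. open X \<Longrightarrow> X \<noteq> {} \<Longrightarrow> \<exists>d\<in>Q. d \<in> X"
    using countable_dense_exists by blast
  define f where "f = (\<lambda>l. \<Sum>j<length l. jet j 0 (l ! j))"
  have "\<exists>x\<in>f ` lists Q. dist x a < e" if "e > 0" for a e
  proof -
    obtain N where N: "dist (\<Sum>j<N. jet j 0 (entry a j)) a < e / 2"
      using metric_LIMSEQ_D[OF finite_support_tendsto half_gt_zero[OF \<open>e > 0\<close>]] by blast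
    have "\<exists>d\<in>Q. d \<in> ball (entry a j) (e / 2)" for j
      using \<open>e > 0\<close> by (intro Q(2)) auto
    then obtain d where d: "\<And>j. d j \<in> Q" "\<And>j. dist (entry a j) (d j) < e / 2"
      unfolding mem_ball by metis
    let ?l = "map d [0..<N]"
    have "dist (f ?l) (\<Sum>j<N. jet j 0 (entry a j)) \<le> e / 2"
      unfolding dist_norm
      by (rule norm_c0_leI)
         (use d(2) \<open>e > 0\<close> in \<open>auto simp: f_def minus_c0.rep_eq entry_sum entry_jet_0
             dist_norm norm_minus_commute less_imp_le\<close>)
    then have "dist (f ?l) a < e"
      using N dist_triangle[of "f ?l" a "\<Sum>j<N. jet j 0 (entry a j)"] by simp
    then show ?thesis
      using d(1) by (intro bexI[of _ "f ?l"] imageI) auto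
  qed
  then have "closure (f ` lists Q) = UNIV"
    unfolding set_eq_iff closure_approachable by blast
  moreover have "countable (f ` lists Q)"
    by (intro countable_image countable_lists Q(1))
  ultimately show ?thesis by blast
qed

section \<open>Herzog spaces as copies of the null sequences\<close>

definition herzog_fun :: "real \<Rightarrow> c0 \<Rightarrow> real \<Rightarrow> complex"
  where "herzog_fun \<rho> a x = (\<Sum>n. entry a n * of_real (\<rho> ^ n) / fact n * of_real x ^ n)"

lemma summable_herzog_series:
  "summable (\<lambda>n. entry a n * of_real (\<rho> ^ n) / fact n * z ^ n)"
proof (rule summable_comparison_test')
  show "summable (\<lambda>n. norm a * ((\<bar>\<rho>\<bar> * cmod z) ^ n /\<^sub>R fact n))"
    using exp_converges by (intro summable_mult) (rule sums_summable)
  fix n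
  have "cmod (entry a n) * ((\<bar>\<rho>\<bar> * cmod z) ^ n /\<^sub>R fact n) \<le> norm a * ((\<bar>\<rho>\<bar> * cmod z) ^ n /\<^sub>R fact n)"
    by (intro mult_right_mono norm_entry_le) simp
  then show "norm (entry a n * of_real (\<rho> ^ n) / fact n * z ^ n) \<le> norm a * ((\<bar>\<rho>\<bar> * cmod z) ^ n /\<^sub>R fact n)"
    by (simp add: norm_mult norm_inverse norm_power power_mult_distrib divide_inverse mult_ac)
qed

lemma herzog_fun_sums:
  "(\<lambda>n. entry a n * of_real (\<rho> ^ n) / fact n * of_real x ^ n) sums herzog_fun \<rho> a x"
  unfolding herzog_fun_def by (rule summable_sums[OF summable_herzog_series])

lemma has_herzog_coeffs_herzog_fun: "has_herzog_coeffs \<rho> (herzog_fun \<rho> a) (entry a)"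
  unfolding has_herzog_coeffs_def using entry_tendsto_0 herzog_fun_sums by blast

lemma herzog_space_eq_range: "herzog_space \<rho> = range (herzog_fun \<rho>)"
proof
  show "range (herzog_fun \<rho>) \<subseteq> herzog_space \<rho>"
    using has_herzog_coeffs_herzog_fun by (auto simp: herzog_space_def)
  show "herzog_space \<rho> \<subseteq> range (herzog_fun \<rho>)"
  proof
    fix f assume "f \<in> herzog_space \<rho>"
    then obtain b where b: "has_herzog_coeffs \<rho> f b"
      by (auto simp: herzog_space_def)
    then have "entry (Abs_c0 b) = b"
      by (intro Abs_c0_inverse) (simp add: has_herzog_coeffs_def)
    then have "f = herzog_fun \<rho> (Abs_c0 b)"
      using b by (auto simp: fun_eq_iff has_herzog_coeffs_def herzog_fun_def intro: sums_unique)
    then show "f \<in> range (herzog_fun \<rho>)" by blast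
  qed
qed

lemma herzog_fun_in_space: "herzog_fun \<rho> a \<in> herzog_space \<rho>"
  by (simp add: herzog_space_eq_range)

lemma herzog_spaceE:
  assumes "f \<in> herzog_space \<rho>"
  obtains a where "f = herzog_fun \<rho> a"
  using assms by (auto simp: herzog_space_eq_range)

lemma herzog_norm_herzog_fun: "\<rho> > 0 \<Longrightarrow> herzog_norm \<rho> (herzog_fun \<rho> a) = norm a"
  by (simp add: herzog_norm_eq[OF _ has_herzog_coeffs_herzog_fun] norm_c0_def)

lemma herzog_fun_inject: "\<rho> > 0 \<Longrightarrow> herzog_fun \<rho> a = herzog_fun \<rho> b \<longleftrightarrow> a = b"
  using has_herzog_coeffs_unique[of \<rho> "herzog_fun \<rho> a" "entry a" "entry b"]
    has_herzog_coeffs_herzog_fun[of \<rho> a] has_herzog_coeffs_herzog_fun[of \<rho> b]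
  by (auto simp: entry_inject)

lemma herzog_fun_add: "herzog_fun \<rho> (a + b) x = herzog_fun \<rho> a x + herzog_fun \<rho> b x"
  by (rule sums_unique2[OF herzog_fun_sums])
     (use sums_add[OF herzog_fun_sums[of a \<rho> x] herzog_fun_sums[of b \<rho> x]] in
       \<open>simp add: plus_c0.rep_eq distrib_right add_divide_distrib\<close>)

lemma herzog_fun_cscale: "herzog_fun \<rho> (cscale c a) x = c * herzog_fun \<rho> a x"
  by (rule sums_unique2[OF herzog_fun_sums])
     (use sums_mult[OF herzog_fun_sums[of a \<rho> x], of c] in \<open>simp add: cscale.rep_eq mult.assoc\<close>)

lemma scaleR_eq_cscale: "r *\<^sub>R a = cscale (of_real r) a"
  by (rule c0_eqI) (simp add: scaleR_c0.rep_eq cscale.rep_eq scaleR_conv_of_real)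

lemma herzog_fun_diff: "herzog_fun \<rho> (a - b) x = herzog_fun \<rho> a x - herzog_fun \<rho> b x"
  using herzog_fun_add[of \<rho> "a - b" b x] by simp

lemma herzog_fun_sum: "herzog_fun \<rho> (\<Sum>i\<in>I. f i) x = (\<Sum>i\<in>I. herzog_fun \<rho> (f i) x)"
proof (induction I rule: infinite_finite_induct)
  case empty
  show ?case using herzog_fun_diff[of \<rho> 0 0 x] by simp
qed (use herzog_fun_diff[of \<rho> 0 0 x] in \<open>simp_all add: herzog_fun_add\<close>)

definition herzog_derivative :: "real \<Rightarrow> c0 \<Rightarrow> c0"
  where "herzog_derivative \<rho> a = cscale (of_real \<rho>) (shift a)"

definition herzog_poly :: "complex poly \<Rightarrow> real \<Rightarrow> c0 \<Rightarrow> c0"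
  where "herzog_poly p \<rho> a = (\<Sum>j\<le>degree p. cscale (coeff p j) ((herzog_derivative \<rho> ^^ j) a))"

lemma derivative_herzog_fun:
  "derivative_operator (herzog_fun \<rho> a) = herzog_fun \<rho> (herzog_derivative \<rho> a)"
proof
  fix x
  define c where "c = (\<lambda>n. entry a n * of_real (\<rho> ^ n) / fact n)"
  have "diffs c n = entry (herzog_derivative \<rho> a) n * of_real (\<rho> ^ n) / fact n" for n
    by (simp add: diffs_def c_def herzog_derivative_def cscale.rep_eq shift.rep_eq divide_simps
        del: of_nat_Suc)
  moreover have "((\<lambda>z. \<Sum>n. c n * z ^ n) has_field_derivative (\<Sum>n. diffs c n * of_real x ^ n)) (at (of_real x))"
    using summable_herzog_series by (intro termdiffs_strong_converges_everywhere) (simp add: c_def)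
  ultimately have "((\<lambda>z. \<Sum>n. c n * z ^ n) has_field_derivative
      herzog_fun \<rho> (herzog_derivative \<rho> a) x) (at (of_real x))"
    by (simp add: herzog_fun_def)
  then have "((\<lambda>x. \<Sum>n. c n * of_real x ^ n) has_vector_derivative
      herzog_fun \<rho> (herzog_derivative \<rho> a) x) (at x)"
    by (rule has_vector_derivative_real_field)
  moreover have "(\<lambda>x. \<Sum>n. c n * of_real x ^ n) = herzog_fun \<rho> a"
    by (simp add: fun_eq_iff herzog_fun_def c_def)
  ultimately show "derivative_operator (herzog_fun \<rho> a) x = herzog_fun \<rho> (herzog_derivative \<rho> a) x"
    by (simp add: derivative_operator_def vector_derivative_at)
qed

lemma poly_operator_herzog_fun:
  "poly_operator p derivative_operator (herzog_fun \<rho> a) = herzog_fun \<rho> (herzog_poly p \<rho> a)"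
proof -
  have "(derivative_operator ^^ j) (herzog_fun \<rho> a) = herzog_fun \<rho> ((herzog_derivative \<rho> ^^ j) a)" for j
    by (rule funpow_intertwine[where B = derivative_operator and F = "herzog_fun \<rho>"])
       (rule derivative_herzog_fun)
  then show ?thesis
    by (simp add: fun_eq_iff poly_operator_def herzog_poly_def herzog_fun_sum herzog_fun_cscale)
qed

lemma bounded_linear_herzog_derivative: "bounded_linear (herzog_derivative \<rho>)"
  unfolding herzog_derivative_def
  by (rule bounded_linear_compose[OF bounded_linear_cscale bounded_linear_shift])

lemma bounded_linear_herzog_poly: "bounded_linear (herzog_poly p \<rho>)"
  unfolding herzog_poly_def
  by (intro bounded_linear_sum bounded_linear_compose[OF bounded_linear_cscale]
      bounded_linear_funpow bounded_linear_herzog_derivative)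

lemma herzog_poly_cscale: "herzog_poly p \<rho> (cscale c a) = cscale c (herzog_poly p \<rho> a)"
proof -
  have comm: "cscale c (cscale d a) = cscale d (cscale c a)" for d a
    by (rule c0_eqI) (simp add: cscale.rep_eq)
  have "herzog_derivative \<rho> (cscale c a) = cscale c (herzog_derivative \<rho> a)" for a
    by (rule c0_eqI) (simp add: herzog_derivative_def cscale.rep_eq shift.rep_eq)
  from funpow_intertwine[of "herzog_derivative \<rho>" "cscale c", OF this]
  show ?thesis
    by (simp add: herzog_poly_def linear_sum[OF bounded_linear.linear[OF bounded_linear_cscale]] comm)
qed

lemma herzog_poly_geom: "herzog_poly p \<rho> (geom w c) = geom w (poly p (of_real \<rho> * w) * c)"
proof -
  have "herzog_derivative \<rho> (geom w c) = geom w (of_real \<rho> * w * c)" for c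
    by (simp add: herzog_derivative_def shift_geom cscale_geom mult.assoc)
  from funpow_intertwine[of "herzog_derivative \<rho>" "geom w", OF this]
  have "(herzog_derivative \<rho> ^^ j) (geom w c) = geom w ((of_real \<rho> * w) ^ j * c)" for j
  proof -
    have "((\<lambda>c. of_real \<rho> * w * c) ^^ j) c = (of_real \<rho> * w) ^ j * c"
      by (induction j) simp_all
    then show ?thesis
      using \<open>(herzog_derivative \<rho> ^^ j) (geom w c) = _\<close> by simp
  qed
  then show ?thesis
    by (simp add: herzog_poly_def cscale_geom poly_altdef sum_distrib_right mult.assoc
        linear_sum[OF bounded_linear.linear[OF bounded_linear_geom]])
qed

interpretation herzog: eigenvector_field "herzog_poly p \<rho>" geom "\<lambda>w. poly p (of_real \<rho> * w)"
  for p \<rho>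
  by (intro eigenvector_field.intro bounded_linear_herzog_poly bounded_linear_geom herzog_poly_geom)

text \<open>
  As \<open>herzog_fun \<rho>\<close> is an isometric bijection onto the Herzog space, the carrier-based limits
  and closures there become those of the type of null sequences.
\<close>

lemma limitin_herzog_fun:
  assumes "\<rho> > 0"
  shows "limitin (norm_topology (herzog_space \<rho>) (herzog_norm \<rho>)) (\<lambda>k. herzog_fun \<rho> (u k)) (herzog_fun \<rho> l) F
    \<longleftrightarrow> (u \<longlongrightarrow> l) F"
  unfolding norm_topology_def Metric_space.limitin_metric[OF Metric_space_herzog[OF assms]] tendsto_iff
  by (simp add: herzog_fun_in_space herzog_norm_herzog_fun[OF assms] dist_norm flip: herzog_fun_diff)

lemma closure_of_herzog_fun:
  assumes "\<rho> > 0"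
  shows "norm_topology (herzog_space \<rho>) (herzog_norm \<rho>) closure_of (herzog_fun \<rho> ` S)
    = herzog_fun \<rho> ` closure S"
proof -
  interpret Metric_space "herzog_space \<rho>" "\<lambda>f g. herzog_norm \<rho> (\<lambda>x. f x - g x)"
    by (rule Metric_space_herzog[OF assms])
  have "herzog_fun \<rho> a \<in> mtopology closure_of (herzog_fun \<rho> ` S) \<longleftrightarrow> a \<in> closure S" for a
    unfolding metric_closure_of closure_approachable
    by (simp add: in_mball herzog_fun_in_space herzog_norm_herzog_fun[OF assms] dist_norm
        norm_minus_commute[of a] flip: herzog_fun_diff)
  moreover have "mtopology closure_of (herzog_fun \<rho> ` S) \<subseteq> herzog_space \<rho>"
    using closure_of_subset_topspace[of mtopology] by simp
  ultimately show ?thesis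
    unfolding norm_topology_def by (auto elim!: herzog_spaceE)
qed

lemma operator_exp_herzog_fun:
  assumes \<rho>: "\<rho> > 0" and A: "bounded_linear A" and B: "\<And>a. B (herzog_fun \<rho> a) = herzog_fun \<rho> (A a)"
  shows "operator_exp (herzog_space \<rho>) (herzog_norm \<rho>) B t (herzog_fun \<rho> a) = herzog_fun \<rho> (op_exp A t a)"
proof -
  have partial: "(\<lambda>x. \<Sum>k<n. of_real (t ^ k / fact k) * (B ^^ k) (herzog_fun \<rho> a) x)
      = herzog_fun \<rho> (\<Sum>k<n. (t ^ k / fact k) *\<^sub>R (A ^^ k) a)" for n
    by (simp add: fun_eq_iff herzog_fun_sum scaleR_eq_cscale herzog_fun_cscale
        funpow_intertwine[of B "herzog_fun \<rho>", OF B])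
  have lim: "limitin (norm_topology (herzog_space \<rho>) (herzog_norm \<rho>))
      (\<lambda>n. herzog_fun \<rho> (\<Sum>k<n. (t ^ k / fact k) *\<^sub>R (A ^^ k) a)) (herzog_fun \<rho> (op_exp A t a)) sequentially"
    unfolding limitin_herzog_fun[OF \<rho>] using op_exp_sums[OF A] by (simp add: sums_def)
  show ?thesis
    unfolding operator_exp_def partial
  proof (rule the_equality[where P = "\<lambda>g. limitin _ _ g _", OF lim])
    show "g = herzog_fun \<rho> (op_exp A t a)"
      if "limitin (norm_topology (herzog_space \<rho>) (herzog_norm \<rho>))
      (\<lambda>n. herzog_fun \<rho> (\<Sum>k<n. (t ^ k / fact k) *\<^sub>R (A ^^ k) a)) g sequentially" for g
      using Metric_space.limitin_metric_unique[OF Metric_space_herzog[OF \<rho>]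
         that[unfolded norm_topology_def] lim[unfolded norm_topology_def]] by simp
  qed
qed

section \<open>Chaos of constant-coefficient evolution equations\<close>

lemma poly_surj:
  fixes p :: "complex poly"
  assumes "degree p > 0"
  shows "\<exists>z. poly p z = q"
proof -
  obtain a r where p: "p = pCons a r" by (cases p)
  then have "r \<noteq> 0" using assms by auto
  then have "\<not> constant (poly (pCons (a - q) r))"
    by (simp add: constant_degree)
  then obtain z where "poly (pCons (a - q) r) z = 0"
    using fundamental_theorem_of_algebra by blast
  then have "poly p z = q"
    by (simp add: p algebra_simps)
  then show ?thesis ..
qed

text \<open>
  Infinitely many eigenvalues of modulus at most 1 suffice: each is attained by p at a point of
  modulus at most r, hence by \<open>w \<mapsto> p (\<rho> w)\<close> at a point of modulus at most \<open>r/\<rho> < 1\<close>.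
  These infinitely many points in a compact disc have an accumulation point there.
\<close>

lemma dense_eigspan:
  assumes deg: "degree p > 0" and r: "0 < r" "r < \<rho>" "\<And>z. cmod (poly p z) \<le> 1 \<Longrightarrow> cmod z \<le> r"
    and Q: "infinite Q" "Q \<subseteq> cball 0 1" and W: "\<And>w. poly p (of_real \<rho> * w) \<in> Q \<Longrightarrow> w \<in> W"
  shows "closure (herzog.eigspan W) = UNIV"
proof -
  define U where "U = {w. poly p (of_real \<rho> * w) \<in> Q}"
  have U: "U \<subseteq> cball 0 (r / \<rho>)"
  proof
    fix w assume "w \<in> U"
    then have "cmod (of_real \<rho> * w) \<le> r"
      using Q(2) by (intro r(3)) (auto simp: U_def)
    then show "w \<in> cball 0 (r / \<rho>)"
      using r by (simp add: norm_mult field_simps)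
  qed
  have "Q \<subseteq> (\<lambda>w. poly p (of_real \<rho> * w)) ` U"
  proof
    fix q assume "q \<in> Q"
    obtain z where "poly p z = q" using poly_surj[OF deg] by blast
    then show "q \<in> (\<lambda>w. poly p (of_real \<rho> * w)) ` U"
      using \<open>q \<in> Q\<close> r by (intro image_eqI[of _ _ "z / of_real \<rho>"]) (auto simp: U_def)
  qed
  then have "infinite U"
    using Q(1) finite_surj by blast
  then obtain v where v: "v \<in> cball 0 (r / \<rho>)" "v islimpt U"
    using U compact_cball[of "0::complex" "r / \<rho>"] unfolding compact_eq_Bolzano_Weierstrass by blast
  have "r / \<rho> < 1"
    using r by simp
  then have "cball 0 (r / \<rho>) \<subseteq> ball (0::complex) 1"
    by auto
  then have "closure (span (\<Union>w\<in>U. range (geom w))) = UNIV"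
    using U v by (intro closure_span_geom[OF _ v(2)]) auto
  moreover have "span (\<Union>w\<in>U. range (geom w)) \<subseteq> herzog.eigspan W"
    unfolding herzog.eigspan_def using W by (intro span_mono) (auto simp: U_def)
  ultimately show ?thesis
    using closure_mono by blast
qed

lemma infinite_scaled_inverses:
  assumes "c \<noteq> (0::complex)"
  shows "infinite ((\<lambda>n. c / of_nat (Suc n)) ` UNIV)"
  by (rule range_inj_infinite) (use assms in \<open>auto simp: inj_on_def field_simps simp flip: of_nat_Suc\<close>)

lemma C0_semigroup_herzog:
  assumes \<rho>: "\<rho> > 0" and dense: "closure (herzog.eigspan U) = UNIV"
  shows "C0_semigroup (herzog_space \<rho>) (herzog_norm \<rho>)
      (operator_exp (herzog_space \<rho>) (herzog_norm \<rho>) (poly_operator p derivative_operator))"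
proof -
  note T = operator_exp_herzog_fun[OF \<rho> bounded_linear_herzog_poly poly_operator_herzog_fun, of p]
  note bl = bounded_linear_op_exp[OF bounded_linear_herzog_poly, of p \<rho>]
  let ?X = "herzog_space \<rho>" and ?N = "herzog_norm \<rho>"
  let ?T = "operator_exp ?X ?N (poly_operator p derivative_operator)"
  have "bounded_operator_on ?X ?N (?T t)" for t
    unfolding bounded_operator_on_def
  proof (intro conjI ballI allI)
    fix f assume "f \<in> ?X"
    then obtain a where f: "f = herzog_fun \<rho> a" by (rule herzog_spaceE)
    show "?T t f \<in> ?X" by (simp add: f T herzog_fun_in_space)
    have "op_exp (herzog_poly p \<rho>) t (cscale c a) = cscale c (op_exp (herzog_poly p \<rho>) t a)" for c
      by (intro op_exp_intertwine bounded_linear_herzog_poly bounded_linear_cscale herzog_poly_cscale)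
    then show "?T t (\<lambda>x. c * f x) = (\<lambda>x. c * ?T t f x)" for c
      by (simp add: f T flip: herzog_fun_cscale)
    fix g assume "g \<in> ?X"
    then obtain b where g: "g = herzog_fun \<rho> b" by (rule herzog_spaceE)
    show "?T t (\<lambda>x. f x + g x) = (\<lambda>x. ?T t f x + ?T t g x)"
      by (simp add: f g T bl_add[OF bl] flip: herzog_fun_add)
  next
    obtain K where "\<And>a. norm (op_exp (herzog_poly p \<rho>) t a) \<le> norm a * K"
      using bounded_linear.bounded[OF bl] by blast
    then show "\<exists>K. \<forall>f\<in>?X. ?N (?T t f) \<le> K * ?N f"
      by (intro exI[of _ K])
         (auto elim!: herzog_spaceE simp: T herzog_norm_herzog_fun[OF \<rho>] mult.commute)
  qed
  moreover have "?T 0 f = f" if "f \<in> ?X" for f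
    using that by (auto elim!: herzog_spaceE simp: T op_exp_0)
  moreover have "?T (s + t) f = ?T s (?T t f)" if "f \<in> ?X" for s t f
    using that by (auto elim!: herzog_spaceE simp: T herzog.op_exp_add[OF dense])
  moreover have "limitin (norm_topology ?X ?N) (\<lambda>s. ?T s f) (?T t f) (at t within {0..})" if "f \<in> ?X" for t f
    using that
    by (auto elim!: herzog_spaceE simp: T limitin_herzog_fun[OF \<rho>]
        intro!: tendsto_within_subset[OF herzog.op_exp_continuous[OF dense] subset_UNIV])
  ultimately show ?thesis
    unfolding C0_semigroup_def by blast
qed

text \<open>
  The eigenvalues \<open>c/n\<close> with \<open>c = -1\<close>, \<open>c = 1\<close> and \<open>c = \<i>\<close> supply the decaying, the
  growing and the periodic eigenvectors.
\<close>

lemma devaney_chaotic_herzog: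
  assumes deg: "degree p > 0" and r: "0 < r" "r < \<rho>" "\<And>z. cmod (poly p z) \<le> 1 \<Longrightarrow> cmod z \<le> r"
  shows "devaney_chaotic_semigroup (herzog_space \<rho>) (herzog_norm \<rho>)
      (operator_exp (herzog_space \<rho>) (herzog_norm \<rho>) (poly_operator p derivative_operator))"
proof -
  have \<rho>: "\<rho> > 0" using r by simp
  note T = operator_exp_herzog_fun[OF \<rho> bounded_linear_herzog_poly poly_operator_herzog_fun, of p]
  have dense: "closure (herzog.eigspan W) = UNIV"
    if "cmod c = 1" "\<And>w n. poly p (of_real \<rho> * w) = c / of_nat (Suc n) \<Longrightarrow> w \<in> W" for c W
  proof (rule dense_eigspan[OF deg r])
    show "infinite (range (\<lambda>n. c / of_nat (Suc n)))"
      using that(1) by (intro infinite_scaled_inverses) auto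
    show "range (\<lambda>n. c / of_nat (Suc n)) \<subseteq> cball 0 1"
      using that(1) by (auto simp: norm_divide divide_le_eq simp del: of_nat_Suc)
    fix w assume "poly p (of_real \<rho> * w) \<in> range (\<lambda>n. c / of_nat (Suc n))"
    then show "w \<in> W"
      using that(2) by blast
  qed
  have neg: "closure (herzog.eigspan {w. Re (poly p (of_real \<rho> * w)) < 0}) = UNIV"
    by (rule dense[of "-1"]) (auto simp del: of_nat_Suc)
  have pos: "closure (herzog.eigspan {w. Re (poly p (of_real \<rho> * w)) > 0}) = UNIV"
    by (rule dense[of 1]) (auto simp del: of_nat_Suc)
  have per: "closure (herzog.eigspan {w. \<exists>n>0. poly p (of_real \<rho> * w) = \<i> / of_nat n}) = UNIV"
    by (rule dense[of \<i>]) (auto simp del: of_nat_Suc)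
  obtain D :: "c0 set" where D: "countable D" "closure D = UNIV"
    using separable_c0 by blast
  obtain a where a: "closure {op_exp (herzog_poly p \<rho>) t a | t. t \<ge> 0} = UNIV"
    using herzog.dense_orbit[OF D neg pos] by blast
  let ?X = "herzog_space \<rho>" and ?N = "herzog_norm \<rho>"
  let ?T = "operator_exp ?X ?N (poly_operator p derivative_operator)"
  have orbit: "{?T t (herzog_fun \<rho> a) | t. t \<ge> 0} = herzog_fun \<rho> ` {op_exp (herzog_poly p \<rho>) t a | t. t \<ge> 0}"
    by (auto simp: T)
  have "norm_topology ?X ?N closure_of {?T t (herzog_fun \<rho> a) | t. t \<ge> 0} = ?X"
    unfolding orbit closure_of_herzog_fun[OF \<rho>] a by (rule herzog_space_eq_range[symmetric])
  moreover have periodic: "{f \<in> ?X. \<exists>t>0. ?T t f = f}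
      = herzog_fun \<rho> ` {a. \<exists>t>0. op_exp (herzog_poly p \<rho>) t a = a}"
    by (auto elim!: herzog_spaceE simp: T herzog_fun_inject[OF \<rho>] herzog_fun_in_space intro!: imageI)
  have "norm_topology ?X ?N closure_of {f \<in> ?X. \<exists>t>0. ?T t f = f} = ?X"
    unfolding periodic closure_of_herzog_fun[OF \<rho>] herzog.dense_periodic_points[OF per]
    by (rule herzog_space_eq_range[symmetric])
  ultimately show ?thesis
    unfolding devaney_chaotic_semigroup_def
    using C0_semigroup_herzog[OF \<rho> neg] herzog_fun_in_space by blast
qed

theorem corollary3p6:
  fixes m :: nat and a :: "nat \<Rightarrow> complex" and p :: "complex poly"
  assumes p: "p = - (\<Sum>j\<le>m. monom (a j) j)"
    and nonconstant: "degree p > 0"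
  shows "\<exists>\<rho>\<^sub>0>0. \<forall>\<rho>>\<rho>\<^sub>0.
    devaney_chaotic_semigroup (herzog_space \<rho>) (herzog_norm \<rho>)
      (operator_exp (herzog_space \<rho>) (herzog_norm \<rho>) (poly_operator p derivative_operator))"
proof -
  obtain b q where pq: "p = pCons b q" by (cases p)
  then have "q \<noteq> 0" using nonconstant by auto
  then obtain r where r: "\<And>z. cmod z \<ge> r \<Longrightarrow> cmod (poly p z) \<ge> 2"
    using poly_infinity[of q 2 b] pq by blast
  \<comment> \<open>the maximum with 1 only makes the radius positive\<close>
  have "cmod z \<le> max r 1" if "cmod (poly p z) \<le> 1" for z
    using r[of z] that by fastforce
  then show ?thesis
    using devaney_chaotic_herzog[OF nonconstant, of "max r 1"] by (intro exI[of _ "max r 1"]) auto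
qed

end
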